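(* For integers $m,p\ge0$ and tuples $K(m+1)=[k,k_1,\dots,k_m]$, $J(p+1)=[j,j_1,\dots,j_p]$ of elements of $\{1,2,3\}$, define $$\mathfrak D_{K(m+1)J(p+1)}:=-\mathrm i\nu\alpha^{3+m+p}\,\boldsymbol e_k\cdot\int_B\boldsymbol\xi\times\Big((\Pi(\boldsymbol\xi))_{K(m)}\big(\boldsymbol\theta_{J(p+1)}+(\Pi(\boldsymbol\xi))_{J(p)}\boldsymbol e_j\times\boldsymbol\xi\big)\Big)\,\mathrm d\boldsymbol\xi .$$ For objects with $\mu_*=\mu_0$ (i.e. $\mu_r=1$) the following symmetry holds: $$\mathfrak D_{K(m+1)J(p+1)}=\mathfrak D_{J(p+1)K(m+1)} .$$
   Context: $B\subset\mathbb R^3$ is a bounded object, $\Gamma=\partial B$, $B^c=\mathbb R^3\setminus\overline B$, $\boldsymbol n$ the unit normal on $\Gamma$, $[\cdot]_\Gamma=\cdot|_+-\cdot|_-$ the jump across $\Gamma$ ($+$ outside, $-$ inside). $\alpha>0$ is a size parameter, $\nu=\omega\sigma_*\mu_0\alpha^2$ (with frequency $\omega$, conductivity $\sigma_*$), $\mu_r=\mu_*/\mu_0>0$ is the object's constant relative permeability, and $\tilde\mu_r=\mu_r$ in $B$, $\tilde\mu_r=1$ in $B^c$. $\boldsymbol e_k$ are the standard basis vectors. For a $p$-tuple $J(p)=[j_1,\dots,j_p]$ with entries in $\{1,2,3\}$, $(\Pi(\boldsymbol\xi))_{J(p)}:=\prod_{\ell=1}^p\xi_{j_\ell}$ (equal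 to $1$ when $J(p)=\emptyset$), and $J(p+1):=[j,J(p)]$; similarly $K(m+1):=[k,K(m)]$. The field $\boldsymbol\theta_{J(p+1)}$ is the solution of the transmission problem \begin{align*} \nabla_\xi\times\mu_r^{-1}\nabla_\xi\times\boldsymbol\theta_{J(p+1)}-\mathrm i\nu\boldsymbol\theta_{J(p+1)}&=\mathrm i\nu(\Pi(\boldsymbol\xi))_{J(p)}\boldsymbol e_j\times\boldsymbol\xi&&\text{in }B,\\ \nabla_\xi\cdot\boldsymbol\theta_{J(p+1)}=0,\qquad\nabla_\xi\times\nabla_\xi\times\boldsymbol\theta_{J(p+1)}&=\boldsymbol0&&\text{in }B^c,\\ [\boldsymbol n\times\boldsymbol\theta_{J(p+1)}]_\Gamma&=\boldsymbol0&&\text{on }\Gamma,\\ [\boldsymbol n\times\tilde\mu_r^{-1}\nabla_\xi\times\boldsymbol\theta_{J(p+1)}]_\Gamma&=-(p+2)[\tilde\mu_r^{-1}]_\Gamma\big(\boldsymbol n\times\boldsymbol e_j(\Pi(\boldsymbol\xi))_{J(p)}\big)&&\text{on }\Gamma,\\ \int_\Gamma\boldsymbol n\cdot\boldsymbol\theta_{J(p+1)}\,\mathrm d\boldsymbol\xi&=0,\\ \boldsymbol\theta_{J(p+1)}&=O(|\boldsymbol\xi|^{-1})&&\text{as }|\boldsymbol\xi|\to\infty . \end{align*} *)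

theory Defs
  imports "HOL-Analysis.Analysis" "HOL-Library.Landau_Symbols"
begin

section \<open>Complex vector fields on \<open>\<real>\<^sup>3\<close>\<close>

definition cvec :: "real^3 \<Rightarrow> complex^3" where
  "cvec x = (\<chi> i. of_real (x $ i))"

text \<open>Scalar and vector product are bilinear, without conjugation; the library's inner
  product on \<^typ>\<open>complex^3\<close> is real-valued and its \<open>cross3\<close> is restricted to \<^typ>\<open>real^3\<close>.\<close>

definition cdot :: "complex^3 \<Rightarrow> complex^3 \<Rightarrow> complex" (infix "\<bullet>\<^sub>c" 70) where
  "a \<bullet>\<^sub>c b = (\<Sum>i\<in>UNIV. a $ i * b $ i)"

definition ccross :: "complex^3 \<Rightarrow> complex^3 \<Rightarrow> complex^3" (infixr "\<times>\<^sub>c" 80) where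
  "a \<times>\<^sub>c b = vector [a$2 * b$3 - a$3 * b$2, a$3 * b$1 - a$1 * b$3, a$1 * b$2 - a$2 * b$1]"

definition partial :: "3 \<Rightarrow> (real^3 \<Rightarrow> 'b::real_normed_vector) \<Rightarrow> real^3 \<Rightarrow> 'b" where
  "partial i F x = frechet_derivative F (at x) (axis i 1)"

definition curl :: "(real^3 \<Rightarrow> complex^3) \<Rightarrow> real^3 \<Rightarrow> complex^3" where
  "curl F x = vector [partial 2 F x $ 3 - partial 3 F x $ 2,
                      partial 3 F x $ 1 - partial 1 F x $ 3,
                      partial 1 F x $ 2 - partial 2 F x $ 1]"

definition divergence :: "(real^3 \<Rightarrow> complex^3) \<Rightarrow> real^3 \<Rightarrow> complex" where
  "divergence F x = (\<Sum>i\<in>UNIV. partial i F x $ i)"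

definition C1_on :: "(real^3) set \<Rightarrow> (real^3 \<Rightarrow> 'b::real_normed_vector) \<Rightarrow> bool" where
  "C1_on S F \<longleftrightarrow> (\<forall>x\<in>S. F differentiable (at x)) \<and> (\<forall>i. continuous_on S (partial i F))"

definition C2_on :: "(real^3) set \<Rightarrow> (real^3 \<Rightarrow> 'b::real_normed_vector) \<Rightarrow> bool" where
  "C2_on S F \<longleftrightarrow> C1_on S F \<and> (\<forall>i. C1_on S (partial i F))"


section \<open>The object, its unit normal, traces and surface measure\<close>

text \<open>Near the boundary point \<open>x\<close> the set \<open>B\<close> is the sublevel set \<open>g < 0\<close> of a \<open>C\<^sup>1\<close> function
  \<open>g\<close> with nowhere vanishing gradient \<open>G\<close>; so \<open>B\<close> lies on one side of its boundary and
  \<open>G\<close> points out of \<open>B\<close>.\<close>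

definition boundary_function ::
    "(real^3) set \<Rightarrow> real^3 \<Rightarrow> (real^3) set \<Rightarrow> (real^3 \<Rightarrow> real) \<Rightarrow> (real^3 \<Rightarrow> real^3) \<Rightarrow> bool" where
  "boundary_function B x U g G \<longleftrightarrow>
     open U \<and> x \<in> U \<and> (\<forall>y\<in>U. GDERIV g y :> G y) \<and> continuous_on U G \<and> (\<forall>y\<in>U. G y \<noteq> 0) \<and>
     B \<inter> U = {y \<in> U. g y < 0} \<and> frontier B \<inter> U = {y \<in> U. g y = 0}"

definition bounded_object :: "(real^3) set \<Rightarrow> bool" where
  "bounded_object B \<longleftrightarrow> open B \<and> bounded B \<and> (\<forall>x\<in>frontier B. \<exists>U g G. boundary_function B x U g G)"

text \<open>The outward unit normal. Uniqueness: any two boundary functions at \<open>x\<close> have gradients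
  at \<open>x\<close> that are positive multiples of each other.\<close>

definition unit_normal :: "(real^3) set \<Rightarrow> real^3 \<Rightarrow> real^3" where
  "unit_normal B x = (THE n. \<exists>U g G. boundary_function B x U g G \<and> n = G x /\<^sub>R norm (G x))"

definition trace_in :: "(real^3) set \<Rightarrow> (real^3 \<Rightarrow> 'b::t2_space) \<Rightarrow> real^3 \<Rightarrow> 'b" where
  "trace_in B F x = Lim (at x within B) F"

definition trace_out :: "(real^3) set \<Rightarrow> (real^3 \<Rightarrow> 'b::t2_space) \<Rightarrow> real^3 \<Rightarrow> 'b" where
  "trace_out B F x = Lim (at x within - closure B) F"

text \<open>\<open>Lim\<close> is only meaningful if the limit exists; for the unknown field this is required in
  \<open>transmission_solution\<close> below.\<close>

definition has_traces :: "(real^3) set \<Rightarrow> (real^3 \<Rightarrow> 'b::t2_space) \<Rightarrow> bool" where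
  "has_traces B F \<longleftrightarrow> (\<forall>x\<in>frontier B.
     (\<exists>l. (F \<longlongrightarrow> l) (at x within B)) \<and> (\<exists>l. (F \<longlongrightarrow> l) (at x within - closure B)))"

definition jump :: "(real^3) set \<Rightarrow> (real^3 \<Rightarrow> 'b::{t2_space,minus}) \<Rightarrow> real^3 \<Rightarrow> 'b" where
  "jump B F x = trace_out B F x - trace_in B F x"

text \<open>Surface measure is the two-dimensional Hausdorff measure, normalised by \<open>pi/4\<close> (the area
  of a disc of unit diameter) so that it is surface area on \<open>C\<^sup>1\<close> surfaces. The set function
  given to \<open>measure_of\<close> is the Hausdorff outer measure; being a metric outer measure, it is
  countably additive on the Borel sets. \<open>bounded\<close> is needed because the library's \<open>diameter\<close>
  is unspecified on unbounded sets.\<close>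

definition surface_measure :: "(real^3) measure" where
  "surface_measure = measure_of UNIV (sets borel)
     (\<lambda>A. SUP \<delta>\<in>{0<..}. INF U\<in>{U :: nat \<Rightarrow> (real^3) set.
            A \<subseteq> (\<Union>i. U i) \<and> (\<forall>i. bounded (U i) \<and> diameter (U i) \<le> \<delta>)}.
          \<Sum>i. ennreal (pi / 4 * (diameter (U i))\<^sup>2))"


section \<open>The transmission problem and the tensor coefficients\<close>

definition mu_tilde :: "(real^3) set \<Rightarrow> real \<Rightarrow> real^3 \<Rightarrow> real" where
  "mu_tilde B \<mu>\<^sub>r \<xi> = (if \<xi> \<in> B then \<mu>\<^sub>r else 1)"

text \<open>The tuple \<open>J(p) = [j\<^sub>1, \<dots>, j\<^sub>p]\<close> is a list of length \<open>p\<close>, and \<open>J(p+1)\<close> is \<open>j # J(p)\<close>. In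
  the type \<open>3\<close> the numeral 3 equals 0, so that its elements are 1, 2, 3.\<close>

definition Pi_mon :: "3 list \<Rightarrow> real^3 \<Rightarrow> real" where
  "Pi_mon J \<xi> = (\<Prod>l\<leftarrow>J. \<xi> $ l)"

abbreviation unit_vec :: "3 \<Rightarrow> complex^3" where
  "unit_vec k \<equiv> axis k 1"

text \<open>Classical solutions of the problem for \<open>\<theta>\<^bsub>J(p+1)\<^esub>\<close> with \<open>J(p+1) = j # J\<close>: twice continuously
  differentiable on either side of the boundary, where the field and its curl have one-sided
  traces. The normal component may jump; the flux condition is the one for the exterior trace.\<close>

definition transmission_solution ::
    "(real^3) set \<Rightarrow> real \<Rightarrow> real \<Rightarrow> 3 \<Rightarrow> 3 list \<Rightarrow> (real^3 \<Rightarrow> complex^3) \<Rightarrow> bool" where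
  "transmission_solution B \<nu> \<mu>\<^sub>r j J \<theta> \<longleftrightarrow>
     C2_on B \<theta> \<and> C2_on (- closure B) \<theta> \<and> has_traces B \<theta> \<and> has_traces B (curl \<theta>) \<and>
     (\<forall>\<xi>\<in>B. curl (\<lambda>y. of_real (inverse \<mu>\<^sub>r) *s curl \<theta> y) \<xi> - (\<i> * of_real \<nu>) *s \<theta> \<xi>
            = (\<i> * of_real \<nu> * of_real (Pi_mon J \<xi>)) *s (unit_vec j \<times>\<^sub>c cvec \<xi>)) \<and>
     (\<forall>\<xi>\<in>- closure B. divergence \<theta> \<xi> = 0 \<and> curl (curl \<theta>) \<xi> = 0) \<and>
     (\<forall>\<xi>\<in>frontier B. jump B (\<lambda>y. cvec (unit_normal B \<xi>) \<times>\<^sub>c \<theta> y) \<xi> = 0) \<and>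
     (\<forall>\<xi>\<in>frontier B.
        jump B (\<lambda>y. cvec (unit_normal B \<xi>) \<times>\<^sub>c (of_real (inverse (mu_tilde B \<mu>\<^sub>r y)) *s curl \<theta> y)) \<xi>
        = - ((of_nat (length J + 2) * of_real (jump B (\<lambda>y. inverse (mu_tilde B \<mu>\<^sub>r y)) \<xi>)) *s
             (cvec (unit_normal B \<xi>) \<times>\<^sub>c (of_real (Pi_mon J \<xi>) *s unit_vec j)))) \<and>
     (LINT \<xi>:frontier B|surface_measure. cvec (unit_normal B \<xi>) \<bullet>\<^sub>c trace_out B \<theta> \<xi>) = 0 \<and>
     (\<lambda>\<xi>. norm (\<theta> \<xi>)) \<in> O[at_infinity](\<lambda>\<xi>. inverse (norm \<xi>))"

text \<open>\<open>\<DD>\<^bsub>K(m+1)J(p+1)\<^esub>\<close> with \<open>K(m+1) = k # K\<close> and \<open>J(p+1) = j # J\<close>, where \<open>\<theta>\<close> is the family of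
  fields indexed by the full tuples.\<close>

definition gmpt ::
    "(real^3) set \<Rightarrow> real \<Rightarrow> real \<Rightarrow> (3 list \<Rightarrow> real^3 \<Rightarrow> complex^3) \<Rightarrow> 3 \<Rightarrow> 3 list \<Rightarrow> 3 \<Rightarrow> 3 list \<Rightarrow> complex"
  where
  "gmpt B \<alpha> \<nu> \<theta> k K j J =
     - (\<i> * of_real \<nu> * of_real \<alpha> ^ (3 + length K + length J)) *
       (unit_vec k \<bullet>\<^sub>c (LINT \<xi>:B|lborel. cvec \<xi> \<times>\<^sub>c (of_real (Pi_mon K \<xi>) *s
          (\<theta> (j # J) \<xi> + of_real (Pi_mon J \<xi>) *s (unit_vec j \<times>\<^sub>c cvec \<xi>)))))"

end

theory Submission
  imports Defs
begin

text \<open>For \<open>\<mu>\<^sub>r = 1\<close> the claim reduces to \<open>\<integral>\<^sub>B f\<^sub>K \<bullet> \<theta>\<^sub>J = \<integral>\<^sub>B f\<^sub>J \<bullet> \<theta>\<^sub>K\<close> for the sources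
  \<open>f\<^sub>J = (\<Pi>)\<^sub>J e\<^sub>j \<times> \<xi>\<close>. The field \<open>F = curl \<theta>\<^sub>K \<times> \<theta>\<^sub>J - curl \<theta>\<^sub>J \<times> \<theta>\<^sub>K\<close> has divergence
  \<open>\<i>\<nu> (f\<^sub>K \<bullet> \<theta>\<^sub>J - f\<^sub>J \<bullet> \<theta>\<^sub>K)\<close> in \<open>B\<close> and \<open>0\<close> outside, and its normal component is continuous across
  the boundary, because it only involves the tangential traces. Hence the distributional divergence
  of \<open>F\<close> has no surface part; no surface integral is needed to see this. Testing with a cutoff
  at radius \<open>R\<close>, the remaining term is \<open>O(1/R)\<close>, since \<open>\<theta> = O(1/R)\<close> and, by Caccioppoli's inequality,
  \<open>curl \<theta>\<close> is of size \<open>R\<^sup>-\<^sup>1\<^sup>/\<^sup>2\<close> in \<open>L\<^sup>2\<close> of the annulus of radius \<open>R\<close>.\<close>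

section \<open>Partial derivatives\<close>

text \<open>The obstacle is regularity at the boundary. The object is only C^1, and while \<theta>
  and curl \<theta> have one-sided limits there, nothing is known about the other first derivatives
  of \<theta>. The combined field is therefore bounded, but on either side only its divergence is
  controlled. For this reason the boundary is used only through its level function g. Near a
  boundary point one partial derivative of g stays away from zero, and k'(g) times this derivative
  is itself the partial derivative of k(g). Integration by parts in that single coordinate direction
  turns quantities concentrated on a thin layer around the surface into volume integrals that
  contain k but not k'. This bounds the volume of the layer, shows that the surface is a null set
  and removes the boundary term, without charts or graphs. At infinity the obstacle is that decay is
  prescribed for \<theta> alone, so that curl \<theta> has no pointwise bound. The tensor
  coefficient also contains a product of two sources; it is symmetric by itself, so only the mixed
  integrals need an argument.\<close>

lemma partial_eq:
  assumes "(F has_derivative F') (at x)"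
  shows "partial i F x = F' (axis i 1)"
  using frechet_derivative_at[OF assms] by (simp add: partial_def)

text \<open>No differentiability is assumed: functions that agree near \<open>x\<close> have the
  same derivatives there, so the choice inside \<open>frechet_derivative\<close> gives the same
  value even if no derivative exists.\<close>

lemma partial_cong_open:
  assumes "open S" "x \<in> S" "\<And>y. y \<in> S \<Longrightarrow> F y = G y"
  shows "partial i F x = partial i G x"
proof -
  have "(F has_derivative F') (at x) \<longleftrightarrow> (G has_derivative F') (at x)" for F'
    using has_derivative_transform_within_open[of F F' x UNIV S G]
      has_derivative_transform_within_open[of G F' x UNIV S F] assms by auto
  then show ?thesis by (simp add: partial_def frechet_derivative_def)
qed

lemma partial_const: "partial i (\<lambda>_. c) x = 0"
  by (rule trans[OF partial_eq[OF has_derivative_const]]) simp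

lemma partial_linear:
  assumes "bounded_linear L" "F differentiable (at x)"
  shows "partial i (\<lambda>y. L (F y)) x = L (partial i F x)"
proof -
  from assms(2) obtain F' where F: "(F has_derivative F') (at x)" by (auto simp: differentiable_def)
  show ?thesis
    using partial_eq[OF bounded_linear.has_derivative[OF assms(1) F]] partial_eq[OF F] by simp
qed

lemma partial_bilinear:
  assumes "bounded_bilinear b" "F differentiable (at x)" "H differentiable (at x)"
  shows "partial i (\<lambda>y. b (F y) (H y)) x = b (F x) (partial i H x) + b (partial i F x) (H x)"
proof -
  from assms obtain F' H' where F: "(F has_derivative F') (at x)" and H: "(H has_derivative H') (at x)"
    by (auto simp: differentiable_def)
  show ?thesis
    using partial_eq[OF bounded_bilinear.FDERIV[OF assms(1) F H]] partial_eq[OF F] partial_eq[OF H] by simp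
qed

lemma partial_add:
  assumes "F differentiable (at x)" "H differentiable (at x)"
  shows "partial i (\<lambda>y. F y + H y) x = partial i F x + partial i H x"
proof -
  from assms obtain F' H' where F: "(F has_derivative F') (at x)" and H: "(H has_derivative H') (at x)"
    by (auto simp: differentiable_def)
  show ?thesis
    using partial_eq[OF has_derivative_add[OF F H]] partial_eq[OF F] partial_eq[OF H] by simp
qed

lemma partial_comp_real:
  fixes f :: "real^3 \<Rightarrow> real" and k k' :: "real \<Rightarrow> real"
  assumes "(k has_real_derivative k' (f x)) (at (f x))" "f differentiable (at x)"
  shows "partial i (\<lambda>y. k (f y)) x = k' (f x) * partial i f x"
proof -
  from assms(2) obtain F' where F: "(f has_derivative F') (at x)" by (auto simp: differentiable_def)
  have "((\<lambda>y. k (f y)) has_derivative (\<lambda>h. k' (f x) * F' h)) (at x)"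
    using has_derivative_compose[OF F assms(1)[unfolded has_field_derivative_def]] by simp
  from partial_eq[OF this] partial_eq[OF F] show ?thesis by simp
qed

lemma differentiable_bilinear:
  assumes "bounded_bilinear b" "F differentiable (at x)" "H differentiable (at x)"
  shows "(\<lambda>y. b (F y) (H y)) differentiable (at x)"
  using assms by (auto simp: differentiable_def dest: bounded_bilinear.FDERIV)

lemma differentiable_linear:
  assumes "bounded_linear L" "F differentiable (at x)"
  shows "(\<lambda>y. L (F y)) differentiable (at x)"
  using assms by (auto simp: differentiable_def dest: bounded_linear.has_derivative)

lemma differentiable_comp_real:
  fixes f :: "real^3 \<Rightarrow> real" and k k' :: "real \<Rightarrow> real"
  assumes "(k has_real_derivative d) (at (f x))" "f differentiable (at x)"
  shows "(\<lambda>y. k (f y)) differentiable (at x)"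
proof -
  from assms(2) obtain F' where F: "(f has_derivative F') (at x)" by (auto simp: differentiable_def)
  from has_derivative_compose[OF F assms(1)[unfolded has_field_derivative_def]]
  show ?thesis by (auto simp: differentiable_def)
qed

section \<open>Calculus of C^1 functions\<close>

lemma C1_onD: "C1_on S F \<Longrightarrow> x \<in> S \<Longrightarrow> F differentiable (at x)"
  "C1_on S F \<Longrightarrow> continuous_on S (partial i F)"
  by (auto simp: C1_on_def)

lemma C1_on_continuous: "C1_on S F \<Longrightarrow> continuous_on S F"
  unfolding C1_on_def
  by (meson continuous_at_imp_continuous_on differentiable_imp_continuous_within)

lemma C1_on_subset: "C1_on S F \<Longrightarrow> T \<subseteq> S \<Longrightarrow> C1_on T F"
  by (auto simp: C1_on_def intro: continuous_on_subset)

lemma C1_on_cong_open: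
  assumes "open S" "\<And>y. y \<in> S \<Longrightarrow> F y = G y" "C1_on S F"
  shows "C1_on S G"
proof -
  have "G differentiable (at x)" if "x \<in> S" for x
  proof -
    from assms that obtain F' where "(F has_derivative F') (at x)"
      by (auto simp: C1_on_def differentiable_def)
    then have "(G has_derivative F') (at x)"
      by (rule has_derivative_transform_within_open) (use assms that in auto)
    then show ?thesis by (auto simp: differentiable_def)
  qed
  moreover have "continuous_on S (partial i G)" for i
    using assms(3) partial_cong_open[OF assms(1) _ assms(2)]
    by (auto simp: C1_on_def cong: continuous_on_cong)
  ultimately show ?thesis by (auto simp: C1_on_def)
qed

text \<open>The gluing device behind the global test fields: a product is C^1 on an open set where
  its factors are, it vanishes off a compact set, and the two open sets cover the space.\<close>

lemma C1_on_Un: "open S \<Longrightarrow> open T \<Longrightarrow> C1_on S F \<Longrightarrow> C1_on T F \<Longrightarrow> C1_on (S \<union> T) F"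
  by (auto simp: C1_on_def intro: continuous_on_open_Un)

lemma C1_on_const: "C1_on S (\<lambda>_. c)"
  by (auto simp: C1_on_def partial_const[abs_def])

lemma C1_on_bounded_linear:
  assumes "bounded_linear L" shows "C1_on S L"
  using partial_eq[OF bounded_linear_imp_has_derivative[OF assms]]
    bounded_linear_imp_differentiable[OF assms]
  by (auto simp: C1_on_def)

lemma C1_on_zero_open: "open S \<Longrightarrow> (\<And>x. x \<in> S \<Longrightarrow> F x = 0) \<Longrightarrow> C1_on S F"
  by (rule C1_on_cong_open[OF _ _ C1_on_const[of S 0]]) auto

lemma C1_on_linear:
  assumes "bounded_linear L" "C1_on S F"
  shows "C1_on S (\<lambda>y. L (F y))"
proof -
  have "continuous_on S (\<lambda>x. L (partial i F x))" for i
    using assms bounded_linear.continuous_on[OF assms(1)] by (auto simp: C1_on_def)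
  then show ?thesis
    using assms by (auto simp: C1_on_def partial_linear differentiable_linear cong: continuous_on_cong)
qed

lemma C1_on_bilinear:
  assumes "bounded_bilinear b" "C1_on S F" "C1_on S H"
  shows "C1_on S (\<lambda>y. b (F y) (H y))"
proof -
  have "continuous_on S (\<lambda>x. b (F x) (partial i H x) + b (partial i F x) (H x))" for i
    using C1_on_continuous[OF assms(2)] C1_on_continuous[OF assms(3)] assms(2,3)
    by (intro continuous_on_add bounded_bilinear.continuous_on[OF assms(1)]) (auto simp: C1_on_def)
  then show ?thesis
    using assms
    by (auto simp: C1_on_def partial_bilinear differentiable_bilinear cong: continuous_on_cong)
qed

lemma C1_on_add:
  assumes "C1_on S F" "C1_on S H"
  shows "C1_on S (\<lambda>y. F y + H y)"
proof -
  have "continuous_on S (\<lambda>x. partial i F x + partial i H x)" for i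
    using assms by (intro continuous_on_add) (auto simp: C1_on_def)
  then show ?thesis
    using assms by (auto simp: C1_on_def partial_add cong: continuous_on_cong)
qed

lemma C1_on_comp_real:
  fixes f :: "real^3 \<Rightarrow> real" and k k' :: "real \<Rightarrow> real"
  assumes k: "\<And>t. (k has_real_derivative k' t) (at t)" "continuous_on UNIV k'" and f: "C1_on S f"
  shows "C1_on S (\<lambda>y. k (f y))"
proof -
  have "continuous_on S (\<lambda>x. k' (f x) * partial i f x)" for i
    using f C1_on_continuous[OF f]
    by (intro continuous_on_mult continuous_on_compose2[OF k(2)]) (auto simp: C1_on_def)
  then show ?thesis
    using f k(1) by (auto simp: C1_on_def partial_comp_real[of k k', OF k(1)]
        intro: differentiable_comp_real cong: continuous_on_cong)
qed

lemmas C1_on_scaleR = C1_on_bilinear[OF bounded_bilinear_scaleR]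
lemmas C1_on_mult = C1_on_bilinear[OF bounded_bilinear_mult]

lemma C1_on_diff: "C1_on S F \<Longrightarrow> C1_on S H \<Longrightarrow> C1_on S (\<lambda>y. F y - H y)"
  using C1_on_add[of S F "\<lambda>y. - H y"] C1_on_linear[OF bounded_linear_minus[OF bounded_linear_ident], of S H]
  by simp

lemma C1_on_real_polynomial:
  fixes p :: "real^3 \<Rightarrow> real"
  assumes "real_polynomial_function p" shows "C1_on S p"
  using assms
  by (induction) (auto intro: C1_on_bounded_linear C1_on_const C1_on_add C1_on_mult)

text \<open>Needed for Weierstrass approximants of complex densities near the surface.
  \<open>polynomial_function\<close> is defined through real-valued linear images, hence the split
  into real and imaginary parts.\<close>

lemma C1_on_polynomial:
  fixes p :: "real^3 \<Rightarrow> complex"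
  assumes "polynomial_function p" shows "C1_on S p"
proof -
  have "C1_on S (\<lambda>x. Re (p x) *\<^sub>R 1 + Im (p x) *\<^sub>R \<i>)"
    using assms bounded_linear_Re bounded_linear_Im
    by (intro C1_on_add C1_on_scaleR C1_on_const C1_on_real_polynomial)
      (auto simp: polynomial_function_def o_def)
  moreover have "(\<lambda>x. Re (p x) *\<^sub>R 1 + Im (p x) *\<^sub>R \<i>) = p"
    by (auto simp: complex_eq_iff)
  ultimately show ?thesis by simp
qed

section \<open>Integrals of derivatives of compactly supported functions\<close>

lemma integrable_compact_support:
  fixes f :: "'a::euclidean_space \<Rightarrow> 'b::{banach, second_countable_topology}"
  assumes "compact K" "continuous_on K f" "\<And>x. x \<notin> K \<Longrightarrow> f x = 0"
  shows "integrable lborel f"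
proof -
  have "(\<lambda>x. indicator K x *\<^sub>R f x) = f" using assms(3) by (auto simp: indicator_def)
  with borel_integrable_compact[OF assms(1,2)] show ?thesis by simp
qed

lemma partial_zero_outside:
  assumes "closed K" "\<And>x. x \<notin> K \<Longrightarrow> F x = 0" "x \<notin> K"
  shows "partial i F x = 0"
  using partial_cong_open[of "- K" x F "\<lambda>_. 0" i] assms by (auto simp: partial_const)

text \<open>Translation invariance: the difference quotients of \<open>F\<close> all have integral zero.\<close>

lemma integral_partial:
  fixes F :: "real^3 \<Rightarrow> 'b::{banach, second_countable_topology}"
  assumes F: "C1_on UNIV F" and K: "compact K" "\<And>x. x \<notin> K \<Longrightarrow> F x = 0"
  shows "integrable lborel (partial i F)" "(LINT x|lborel. partial i F x) = 0"
proof -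
  have contF: "continuous_on T F" and contP: "continuous_on T (partial i F)" for T
    using F C1_on_continuous[OF F] by (auto simp: C1_on_def intro: continuous_on_subset)
  have P0: "partial i F x = 0" if "x \<notin> K" for x
    by (rule partial_zero_outside[OF compact_imp_closed[OF K(1)] K(2) that])
  show int: "integrable lborel (partial i F)"
    by (rule integrable_compact_support[OF K(1) contP P0])
  have intF: "integrable lborel F"
    by (rule integrable_compact_support[OF K(1) contF K(2)])
  have "bounded (partial i F ` K)"
    by (intro compact_imp_bounded compact_continuous_image contP K)
  then obtain M where M: "\<And>x. x \<in> K \<Longrightarrow> norm (partial i F x) \<le> M" "M > 0"
    by (auto simp: bounded_pos)
  have MM: "norm (partial i F x) \<le> M" for x
    using M P0 by (cases "x \<in> K") auto
  obtain R where R: "\<And>x. x \<in> K \<Longrightarrow> norm x \<le> R"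
    using compact_imp_bounded[OF K(1)] by (auto simp: bounded_iff)
  let ?e = "axis i (1::real) :: real^3"
  have der: "((\<lambda>t. F (x + t *\<^sub>R ?e)) has_derivative (\<lambda>h. h *\<^sub>R partial i F (x + t *\<^sub>R ?e))) (at t within T)"
    for x t T
  proof -
    obtain F' where F': "(F has_derivative F') (at (x + t *\<^sub>R ?e))"
      using F by (auto simp: C1_on_def differentiable_def)
    have "((\<lambda>t. x + t *\<^sub>R ?e) has_derivative (\<lambda>h. h *\<^sub>R ?e)) (at t within T)"
      by (auto intro!: derivative_eq_intros)
    from has_derivative_compose[OF this F']
    show ?thesis using partial_eq[OF F'] linear_scale[OF has_derivative_linear[OF F']] by simp
  qed
  \<comment> \<open>Shifts of length at most 1 keep the support of \<open>q n\<close> in the ball of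
    radius \<open>R + 1\<close>, so one dominating function serves all \<open>n\<close>.\<close>
  define t where "t n = 1 / real (Suc n)" for n
  have t: "t n > 0" "t n \<le> 1" for n by (auto simp: t_def)
  define q where "q n x = (F (x + t n *\<^sub>R ?e) - F x) /\<^sub>R t n" for n x
  have intT: "integrable lborel (\<lambda>x. F (x + t n *\<^sub>R ?e))"
    and eqT: "(LINT x|lborel. F (x + t n *\<^sub>R ?e)) = (LINT x|lborel. F x)" for n
  proof -
    have m: "(+) (t n *\<^sub>R ?e) \<in> lborel \<rightarrow>\<^sub>M borel" by simp
    have F_m: "F \<in> borel_measurable borel" using contF by (rule borel_measurable_continuous_onI)
    show "integrable lborel (\<lambda>x. F (x + t n *\<^sub>R ?e))"
      using integrable_distr_eq[OF m F_m] intF by (simp add: lborel_distr_plus add.commute)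
    show "(LINT x|lborel. F (x + t n *\<^sub>R ?e)) = (LINT x|lborel. F x)"
      using integral_distr[OF m F_m] by (simp add: lborel_distr_plus add.commute)
  qed
  have q0: "(LINT x|lborel. q n x) = 0" for n
    unfolding q_def using intT eqT intF by simp
  have "(\<lambda>n. LINT x|lborel. q n x) \<longlonglongrightarrow> (LINT x|lborel. partial i F x)"
  proof (rule integral_dominated_convergence[where w="\<lambda>x. indicator (cball 0 (R + 1)) x *\<^sub>R M"])
    show "partial i F \<in> borel_measurable lborel" using int by auto
    show "q n \<in> borel_measurable lborel" for n
      unfolding q_def using intT intF by (intro borel_measurable_scaleR borel_measurable_diff) auto
    show "integrable lborel (\<lambda>x. indicator (cball 0 (R + 1)) x *\<^sub>R M)"
      by (rule borel_integrable_compact) auto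
    show "AE x in lborel. (\<lambda>n. q n x) \<longlonglongrightarrow> partial i F x"
    proof (rule AE_I2)
      fix x
      have "((\<lambda>h. norm (F (x + h *\<^sub>R ?e) - F x - h *\<^sub>R partial i F x) / norm h) \<longlongrightarrow> 0) (at 0)"
        using der[of x 0 UNIV] by (simp add: has_derivative_at)
      moreover have "filterlim t (at 0) sequentially"
        unfolding filterlim_at t_def[abs_def] using LIMSEQ_inverse_real_of_nat
        by (auto simp: inverse_eq_divide)
      ultimately have "(\<lambda>n. norm (F (x + t n *\<^sub>R ?e) - F x - t n *\<^sub>R partial i F x) / norm (t n)) \<longlonglongrightarrow> 0"
        by (rule filterlim_compose)
      moreover have "norm (F (x + t n *\<^sub>R ?e) - F x - t n *\<^sub>R partial i F x) / norm (t n)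
          = norm (q n x - partial i F x)" for n
      proof -
        have "q n x - partial i F x = (F (x + t n *\<^sub>R ?e) - F x - t n *\<^sub>R partial i F x) /\<^sub>R t n"
          using t[of n] by (simp add: q_def scaleR_diff_right)
        then show ?thesis using t[of n] by (simp add: divide_inverse)
      qed
      ultimately show "(\<lambda>n. q n x) \<longlonglongrightarrow> partial i F x"
        by (simp add: LIM_zero_iff tendsto_norm_zero_iff)
    qed
    show "AE x in lborel. norm (q n x) \<le> indicator (cball 0 (R + 1)) x *\<^sub>R M" for n
    proof (rule AE_I2)
      fix x
      show "norm (q n x) \<le> indicator (cball 0 (R + 1)) x *\<^sub>R M"
      proof (cases "norm x \<le> R + 1")
        case True
        \<comment> \<open>Mean value inequality along the coordinate line: the quotient inherits the
          bound \<open>M\<close> of the partial derivative.\<close>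
        have "norm (F (x + t n *\<^sub>R ?e) - F (x + 0 *\<^sub>R ?e)) \<le> M * norm (t n - 0)"
          by (rule differentiable_bound[where S=UNIV, OF _ der])
            (use MM in \<open>auto intro!: onorm_le simp: mult.commute[of M] mult_left_mono\<close>)
        moreover have "norm (q n x) = norm (F (x + t n *\<^sub>R ?e) - F x) / t n"
          using t[of n] by (simp add: q_def divide_inverse)
        ultimately show ?thesis using True t[of n] by (simp add: pos_divide_le_eq)
      next
        case False
        have "norm (x + t n *\<^sub>R ?e) \<ge> norm x - norm (t n *\<^sub>R ?e)"
          by (metis add_diff_cancel_right' norm_triangle_ineq4 diff_le_eq add.commute norm_diff_ineq)
        then have "norm (x + t n *\<^sub>R ?e) > R" using False t[of n] by simp
        then have "F (x + t n *\<^sub>R ?e) = 0" "F x = 0" using R K(2) False by force+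
        then show ?thesis using False by (simp add: q_def)
      qed
    qed
  qed
  then show "(LINT x|lborel. partial i F x) = 0" by (simp add: q0 LIMSEQ_const_iff)
qed

section \<open>Vector calculus and cutoff functions\<close>

definition grad :: "(real^3 \<Rightarrow> real) \<Rightarrow> real^3 \<Rightarrow> real^3" where
  "grad f x = (\<chi> i. partial i f x)"

lemma cdot_3: "a \<bullet>\<^sub>c b = a$1 * b$1 + a$2 * b$2 + a$3 * b$3"
  by (simp add: cdot_def sum_3)

lemma ccross_nth:
  "(a \<times>\<^sub>c b) $ 1 = a$2 * b$3 - a$3 * b$2"
  "(a \<times>\<^sub>c b) $ 2 = a$3 * b$1 - a$1 * b$3"
  "(a \<times>\<^sub>c b) $ 3 = a$1 * b$2 - a$2 * b$1"
  by (simp_all add: ccross_def)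

lemma bounded_bilinear_cdot: "bounded_bilinear (\<bullet>\<^sub>c)"
  unfolding bilinear_conv_bounded_bilinear[symmetric] bilinear_def
  by (auto intro!: linearI simp: cdot_3 algebra_simps)

lemma bounded_bilinear_ccross: "bounded_bilinear (\<times>\<^sub>c)"
  unfolding bilinear_conv_bounded_bilinear[symmetric] bilinear_def
  by (auto intro!: linearI simp: vec_eq_iff forall_3 ccross_nth algebra_simps)

lemma bounded_linear_cvec: "bounded_linear cvec"
  unfolding linear_conv_bounded_linear[symmetric]
  by (auto intro!: linearI simp: cvec_def vec_eq_iff scaleR_conv_of_real[where 'a=complex])

lemma cvec_simps [simp]:
  "cvec 0 = 0" "cvec (a + b) = cvec a + cvec b" "cvec (t *\<^sub>R a) = t *\<^sub>R cvec a"
  by (simp_all add: cvec_def vec_eq_iff scaleR_conv_of_real[where 'a=complex])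

lemma cdot_simps [simp]:
  "0 \<bullet>\<^sub>c a = 0" "a \<bullet>\<^sub>c 0 = 0"
  by (simp_all add: cdot_def)

lemmas C1_on_ccross = C1_on_bilinear[OF bounded_bilinear_ccross]
lemmas C1_on_vec_nth = C1_on_linear[OF bounded_linear_vec_nth]

lemma partial_vec_nth: "F differentiable (at x) \<Longrightarrow> partial i (\<lambda>y. F y $ l) x = partial i F x $ l"
  by (rule partial_linear[OF bounded_linear_vec_nth])

lemma divergence_cong_open:
  assumes "open S" "x \<in> S" "\<And>y. y \<in> S \<Longrightarrow> F y = G y"
  shows "divergence F x = divergence G x"
  using partial_cong_open[OF assms] by (simp add: divergence_def)

lemma grad_zero_outside:
  assumes "closed K" "\<And>x. x \<notin> K \<Longrightarrow> f x = 0" "x \<notin> K"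
  shows "grad f x = 0"
  using partial_zero_outside[OF assms] by (simp add: grad_def vec_eq_iff)

lemma divergence_zero_outside:
  assumes "closed K" "\<And>x. x \<notin> K \<Longrightarrow> F x = 0" "x \<notin> K"
  shows "divergence F x = 0"
  using partial_zero_outside[OF assms] by (simp add: divergence_def)

lemma grad_continuous: "C1_on S f \<Longrightarrow> continuous_on S (grad f)"
  unfolding grad_def[abs_def] by (intro continuous_on_vec_lambda) (auto simp: C1_on_def)

lemma integral_divergence:
  assumes V: "C1_on UNIV V" and K: "compact K" "\<And>x. x \<notin> K \<Longrightarrow> V x = 0"
  shows "integrable lborel (divergence V)" "(LINT x|lborel. divergence V x) = 0"
proof -
  have *: "divergence V = (\<lambda>x. \<Sum>i\<in>UNIV. partial i (\<lambda>y. V y $ i) x)"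
    using V by (auto simp: divergence_def fun_eq_iff partial_vec_nth C1_on_def)
  have i: "integrable lborel (partial i (\<lambda>y. V y $ i))"
    and e: "(LINT x|lborel. partial i (\<lambda>y. V y $ i) x) = 0" for i
    using integral_partial[OF C1_on_vec_nth[OF V] K(1)] K(2) by auto
  show "integrable lborel (divergence V)" unfolding * using i by auto
  show "(LINT x|lborel. divergence V x) = 0" unfolding * using i e by simp
qed

lemma divergence_scaleR:
  assumes "f differentiable (at x)" "F differentiable (at x)"
  shows "divergence (\<lambda>y. f y *\<^sub>R F y) x = cvec (grad f x) \<bullet>\<^sub>c F x + f x *\<^sub>R divergence F x"
  using assms
  by (simp add: divergence_def partial_bilinear[OF bounded_bilinear_scaleR] cdot_def cvec_def grad_def
      sum.distrib scaleR_sum_right) (simp add: scaleR_conv_of_real)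

lemma curl_nth:
  "curl F x $ 1 = partial 2 F x $ 3 - partial 3 F x $ 2"
  "curl F x $ 2 = partial 3 F x $ 1 - partial 1 F x $ 3"
  "curl F x $ 3 = partial 1 F x $ 2 - partial 2 F x $ 1"
  by (simp_all add: curl_def)

lemma divergence_ccross:
  assumes "F differentiable (at x)" "H differentiable (at x)"
  shows "divergence (\<lambda>y. F y \<times>\<^sub>c H y) x = curl F x \<bullet>\<^sub>c H x - F x \<bullet>\<^sub>c curl H x"
  using assms
  by (simp add: divergence_def partial_bilinear[OF bounded_bilinear_ccross] sum_3 cdot_3 curl_nth
     ccross_nth algebra_simps)

lemma C1_on_vec:
  fixes F :: "real^3 \<Rightarrow> complex^3"
  assumes "\<And>l. C1_on S (\<lambda>x. F x $ l)" shows "C1_on S F"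
proof -
  have "bounded_linear (\<lambda>z::complex. axis l z :: complex^3)" for l
    unfolding linear_conv_bounded_linear[symmetric]
    by (auto intro!: linearI simp: vec_eq_iff axis_def)
  from C1_on_linear[OF this assms]
  have "C1_on S (\<lambda>x. axis 1 (F x $ 1) + axis 2 (F x $ 2) + axis 3 (F x $ 3) :: complex^3)"
    by (intro C1_on_add)
  moreover have "(\<lambda>x. axis 1 (F x $ 1) + axis 2 (F x $ 2) + axis 3 (F x $ 3) :: complex^3) = F"
    by (auto simp: fun_eq_iff vec_eq_iff forall_3 axis_def)
  ultimately show ?thesis by simp
qed

lemma C1_on_curl:
  assumes "C2_on S F" shows "C1_on S (curl F)"
proof -
  have P: "C1_on S (\<lambda>x. partial i F x $ l)" for i l
    using assms by (intro C1_on_vec_nth) (auto simp: C2_on_def)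
  have "\<forall>l. C1_on S (\<lambda>x. curl F x $ l)"
    by (auto simp: forall_3 curl_nth intro!: C1_on_diff P)
  then show ?thesis by (blast intro: C1_on_vec)
qed

section \<open>A C^1 cutoff function\<close>

definition step :: "real \<Rightarrow> real" where
  "step t = (max 0 t)\<^sup>2 / ((max 0 t)\<^sup>2 + (max 0 (1 - t))\<^sup>2)"

text \<open>With a = max 0 t and b = max 0 (1 - t), \<open>step\<close> is a^2 / (a^2 + b^2).
  Squaring smooths the kinks of a and b, and the two are never both zero. In the quotient rule the
  terms a^3 cancel, leaving 2 a b (a + b), from which sign and support are visible. One continuous
  derivative is enough, because test functions are only required to be C^1.\<close>

definition step' :: "real \<Rightarrow> real" where
  "step' t = 2 * max 0 t * max 0 (1 - t) * (max 0 t + max 0 (1 - t)) / ((max 0 t)\<^sup>2 + (max 0 (1 - t))\<^sup>2)\<^sup>2"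

lemma step_denominator: "(max 0 t)\<^sup>2 + (max 0 (1 - t))\<^sup>2 > (0::real)"
proof (cases "t > 0")
  case True
  then show ?thesis by (intro add_pos_nonneg) auto
next
  case False
  then show ?thesis by (intro add_nonneg_pos) auto
qed

lemma max_square_has_derivative: "((\<lambda>t::real. (max 0 t)\<^sup>2) has_real_derivative 2 * max 0 t) (at t)"
proof -
  consider "t > 0" | "t < 0" | "t = 0" by linarith
  then show ?thesis
  proof cases
    case 1
    have "((\<lambda>t::real. t\<^sup>2) has_real_derivative 2 * t) (at t)" by (auto intro!: derivative_eq_intros)
    then have "((\<lambda>t::real. (max 0 t)\<^sup>2) has_real_derivative 2 * t) (at t)"
      by (rule has_field_derivative_transform_within_open[where S="{0<..}"]) (use 1 in auto)
    then show ?thesis using 1 by simp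
  next
    case 2
    have "((\<lambda>t::real. 0) has_real_derivative 0) (at t)" by simp
    then have "((\<lambda>t::real. (max 0 t)\<^sup>2) has_real_derivative 0) (at t)"
      by (rule has_field_derivative_transform_within_open[where S="{..<0}"]) (use 2 in auto)
    then show ?thesis using 2 by simp
  next
    case 3
    have "((\<lambda>h::real. max 0 h) \<longlongrightarrow> max 0 0) (at 0)"
      by (intro tendsto_intros)
    moreover have "((max 0 (0 + h))\<^sup>2 - (max 0 0)\<^sup>2) / h = max 0 h" for h :: real
      by (auto simp: max_def power2_eq_square)
    ultimately show ?thesis using 3 by (simp add: DERIV_def)
  qed
qed

lemma step_has_derivative: "(step has_real_derivative step' t) (at t)"
proof -
  have "((\<lambda>t::real. 1 - t) has_real_derivative - 1) (at t)" by (auto intro!: derivative_eq_intros)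
  from DERIV_chain2[OF max_square_has_derivative this]
  have A: "((\<lambda>t::real. (max 0 (1 - t))\<^sup>2) has_real_derivative - 2 * max 0 (1 - t)) (at t)" by simp
  have "(step has_real_derivative (2 * max 0 t * ((max 0 t)\<^sup>2 + (max 0 (1 - t))\<^sup>2)
     - (max 0 t)\<^sup>2 * (2 * max 0 t + - 2 * max 0 (1 - t)))
     / (((max 0 t)\<^sup>2 + (max 0 (1 - t))\<^sup>2) * ((max 0 t)\<^sup>2 + (max 0 (1 - t))\<^sup>2))) (at t)"
    unfolding step_def[abs_def]
    by (intro DERIV_divide DERIV_add max_square_has_derivative A less_imp_neq[OF step_denominator, symmetric])
  moreover have "2 * a * (a\<^sup>2 + b\<^sup>2) - a\<^sup>2 * (2 * a + - 2 * b) = 2 * a * b * (a + b)" for a b :: real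
    by (simp add: power2_eq_square algebra_simps)
  ultimately show ?thesis by (simp add: step'_def power2_eq_square)
qed

lemma step'_continuous: "continuous_on UNIV step'"
  unfolding step'_def[abs_def]
  by (intro continuous_intros ballI less_imp_neq[symmetric] zero_less_power step_denominator)

lemma step'_nonneg: "step' t \<ge> 0"
  by (simp add: step'_def)

lemma step'_zero: "t \<le> 0 \<or> t \<ge> 1 \<Longrightarrow> step' t = 0"
  by (auto simp: step'_def max_def)

lemma step_values: "t \<le> 0 \<Longrightarrow> step t = 0" "t \<ge> 1 \<Longrightarrow> step t = 1"
  by (auto simp: step_def max_def)

lemma step_bounds: "0 \<le> step t" "step t \<le> 1"
  using step_denominator[of t] by (auto simp: step_def divide_le_eq)

lemma step'_bounded: "\<exists>M>0. \<forall>t. step' t \<le> M"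
proof -
  have "bounded (step' ` {0..1})"
    by (intro compact_imp_bounded compact_continuous_image continuous_on_subset[OF step'_continuous]) auto
  then obtain M where M: "M > 0" "\<And>t. t \<in> {0..1} \<Longrightarrow> norm (step' t) \<le> M" by (auto simp: bounded_pos)
  have "step' t \<le> M" for t
    using M(2)[of t] M(1) step'_zero[of t] by (cases "t \<in> {0..1}") auto
  with M show ?thesis by auto
qed

text \<open>The argument of \<open>step\<close> is a polynomial in \<open>y\<close>, so the centre
  causes no singularity. It equals 1 at distance r / sqrt 2 and 0 at distance \<open>r\<close>; the
  plateau is only ever used up to r / 2.\<close>

definition bump :: "real^3 \<Rightarrow> real \<Rightarrow> real^3 \<Rightarrow> real" where
  "bump c r y = step (2 - 2 / r\<^sup>2 * ((y - c) \<bullet> (y - c)))"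

lemma bump_bounds: "0 \<le> bump c r y" "bump c r y \<le> 1"
  by (simp_all add: bump_def step_bounds)

lemma bump_1: "r > 0 \<Longrightarrow> dist c y \<le> r / 2 \<Longrightarrow> bump c r y = 1"
proof -
  assume "r > 0" "dist c y \<le> r / 2"
  then have "(norm (y - c))\<^sup>2 \<le> (r / 2)\<^sup>2" by (intro power_mono) (auto simp: dist_norm norm_minus_commute)
  with \<open>r > 0\<close> show ?thesis
    by (auto simp: bump_def dot_square_norm divide_simps intro!: step_values)
      (use zero_le_power2[of "norm (y - c)"] in linarith)
qed

lemma bump_0: "r > 0 \<Longrightarrow> dist c y \<ge> r \<Longrightarrow> bump c r y = 0"
proof -
  assume "r > 0" "dist c y \<ge> r"
  then have "(norm (y - c))\<^sup>2 \<ge> r\<^sup>2" by (intro power_mono) (auto simp: dist_norm norm_minus_commute)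
  with \<open>r > 0\<close> show ?thesis
    by (auto simp: bump_def dot_square_norm field_simps intro!: step_values)
qed

lemma C1_on_square: "C1_on S (\<lambda>y. (y - c) \<bullet> (y - c))"
  by (intro C1_on_bilinear[OF bounded_bilinear_inner] C1_on_diff C1_on_const
       C1_on_bounded_linear bounded_linear_ident)

lemma C1_on_bump: "C1_on S (bump c r)"
  unfolding bump_def[abs_def]
  by (intro C1_on_comp_real[OF step_has_derivative step'_continuous] C1_on_diff C1_on_mult C1_on_const
      C1_on_square)

lemma partial_bump: "partial i (bump c r) y = step' (2 - 2 / r\<^sup>2 * ((y - c) \<bullet> (y - c))) * (- 4 / r\<^sup>2 * (y - c) $ i)"
proof -
  have "((\<lambda>y. 2 - a * ((y - c) \<bullet> (y - c))) has_derivative (\<lambda>h. - (a * (2 * ((y - c) \<bullet> h))))) (at y)" for a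
    by (auto intro!: derivative_eq_intros simp: inner_commute)
  from partial_eq[OF this, of i "2 / r\<^sup>2"]
  have p: "partial i (\<lambda>y. 2 - 2 / r\<^sup>2 * ((y - c) \<bullet> (y - c))) y = - 4 / r\<^sup>2 * (y - c) $ i"
    by (simp add: inner_axis)
  show ?thesis unfolding bump_def[abs_def] p[symmetric]
    by (rule partial_comp_real[OF step_has_derivative])
      (rule C1_onD(1)[of UNIV, OF _ UNIV_I], intro C1_on_diff C1_on_mult C1_on_const C1_on_square)
qed

text \<open>On the ball of radius \<open>r\<close> the inner derivative is at most 4 / r, and
  outside it \<open>step'\<close> vanishes; three components give the factor 12. Uniformity in the
  radius supplies the factor 1/R in the far field.\<close>

lemma grad_bump_bound: "\<exists>M>0. \<forall>c r y. r > 0 \<longrightarrow> norm (grad (bump c r) y) \<le> M / r"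
proof -
  obtain M where M: "M > 0" "\<And>t. step' t \<le> M" using step'_bounded by auto
  have "norm (grad (bump c r) y) \<le> 12 * M / r" if r: "r > 0" for c r y
  proof -
    have "\<bar>partial i (bump c r) y\<bar> \<le> 4 * M / r" for i
    proof (cases "norm (y - c) \<ge> r")
      case True
      then have "(norm (y - c))\<^sup>2 \<ge> r\<^sup>2" using r by (intro power_mono) auto
      then have "step' (2 - 2 / r\<^sup>2 * ((y - c) \<bullet> (y - c))) = 0" using r
        by (auto simp: dot_square_norm field_simps intro!: step'_zero)
      then show ?thesis using M r by (simp add: partial_bump)
    next
      case False
      have "\<bar>partial i (bump c r) y\<bar> = step' (2 - 2 / r\<^sup>2 * ((y - c) \<bullet> (y - c))) * (4 / r\<^sup>2 * \<bar>(y - c) $ i\<bar>)"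
        by (simp only: partial_bump abs_mult) (use step'_nonneg in simp)
      also have "\<dots> \<le> M * (4 / r\<^sup>2 * r)"
        using False component_le_norm_cart[of "y - c" i] M r step'_nonneg
        by (intro mult_mono) auto
      also have "\<dots> = 4 * M / r" using r by (simp add: power2_eq_square)
      finally show ?thesis .
    qed
    then have "(\<Sum>i\<in>UNIV. \<bar>grad (bump c r) y $ i\<bar>) \<le> (\<Sum>i\<in>(UNIV::3 set). 4 * M / r)"
      by (intro sum_mono) (simp add: grad_def)
    also have "\<dots> = 12 * M / r" by simp
    finally show ?thesis using norm_le_l1_cart order_trans by blast
  qed
  then show ?thesis using M(1) by (intro exI[of _ "12 * M"]) auto
qed

section \<open>Weak divergence across a surface\<close>

text \<open>A piece of the surface seen through its level function: the coordinate direction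
  \<open>i\<close> crosses the level sets of \<open>g\<close> with slope at least \<open>c\<close>,
  and \<open>s\<close> is the sign of that slope. The doubled radius leaves room for a bump that
  equals 1 on \<open>cball x0 r\<close>, where the test functions live.\<close>

locale boundary_patch =
  fixes U :: "(real^3) set" and g :: "real^3 \<Rightarrow> real" and x0 :: "real^3" and r s c :: real and i :: 3
  assumes open_U: "open U" and C1_g: "C1_on U g" and r: "r > 0" and ball_U: "cball x0 (2 * r) \<subseteq> U"
    and s: "\<bar>s\<bar> = 1" and c: "c > 0"
    and transversal: "\<And>y. y \<in> cball x0 (2 * r) \<Longrightarrow> c \<le> s * partial i g y"
begin

lemma small_ball_U: "cball x0 r \<subseteq> U"
  using ball_U r by (auto intro!: subsetD[OF ball_U])

lemma continuous_g: "continuous_on U g"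
  by (rule C1_on_continuous[OF C1_g])

text \<open>As k'(g) times \<open>partial i g\<close> is the partial derivative of k(g), this is
  integration by parts for k(g) q, extended by zero beyond the ball. It trades a possibly huge k'
  for a bounded k.\<close>

lemma chain:
  fixes q :: "real^3 \<Rightarrow> 'b::{banach, second_countable_topology}"
  assumes q: "C1_on UNIV q" "\<And>y. y \<notin> cball x0 (2 * r) \<Longrightarrow> q y = 0"
    and k: "\<And>t. (k has_real_derivative k' t) (at t)" "continuous_on UNIV k'"
  shows "integrable lborel (\<lambda>y. k (g y) *\<^sub>R partial i q y)"
    and "integrable lborel (\<lambda>y. (k' (g y) * partial i g y) *\<^sub>R q y)"
    and "(LINT y|lborel. (k' (g y) * partial i g y) *\<^sub>R q y) = - (LINT y|lborel. k (g y) *\<^sub>R partial i q y)"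
proof -
  let ?K = "cball x0 (2 * r)"
  have q0: "partial i q y = 0" if "y \<notin> ?K" for y
    by (rule partial_zero_outside[OF closed_cball q(2) that])
  have kg: "C1_on U (\<lambda>y. k (g y))" by (rule C1_on_comp_real[OF k C1_g])
  have ck: "continuous_on ?K (\<lambda>y. k (g y))"
    using C1_on_continuous[OF kg] ball_U continuous_on_subset by blast
  have "continuous_on ?K g" using continuous_g ball_U continuous_on_subset by blast
  then have ck': "continuous_on ?K (\<lambda>y. k' (g y))"
    by (intro continuous_on_compose2[OF k(2)]) auto
  have cq: "continuous_on ?K q" "continuous_on ?K (partial i q)"
    using q(1) C1_on_continuous[OF q(1)] by (auto simp: C1_on_def intro: continuous_on_subset)
  have cg: "continuous_on ?K (partial i g)"
    using C1_g ball_U by (auto simp: C1_on_def intro: continuous_on_subset)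
  show i1: "integrable lborel (\<lambda>y. k (g y) *\<^sub>R partial i q y)"
    using ck cq q0 by (intro integrable_compact_support[of ?K]) (auto intro!: continuous_intros)
  show i2: "integrable lborel (\<lambda>y. (k' (g y) * partial i g y) *\<^sub>R q y)"
    using ck' cq cg q(2) by (intro integrable_compact_support[of ?K]) (auto intro!: continuous_intros)
  let ?P = "\<lambda>y. k (g y) *\<^sub>R q y"
  have "C1_on (U \<union> - ?K) ?P"
    by (intro C1_on_Un open_U C1_on_scaleR kg C1_on_subset[OF q(1)] C1_on_zero_open) (auto simp: q(2))
  moreover have "U \<union> - ?K = UNIV" using ball_U by auto
  ultimately have P: "C1_on UNIV ?P" by simp
  have "partial i ?P y = (k' (g y) * partial i g y) *\<^sub>R q y + k (g y) *\<^sub>R partial i q y" for y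
  proof (cases "y \<in> ?K")
    case True
    then have y: "y \<in> U" using ball_U by auto
    show ?thesis
      using partial_bilinear[OF bounded_bilinear_scaleR C1_onD(1)[OF kg y] C1_onD(1)[OF q(1) UNIV_I], of i]
        partial_comp_real[of k k' g, OF k(1) C1_onD(1)[OF C1_g y], of i] by simp
  next
    case False
    then show ?thesis using partial_zero_outside[OF closed_cball _ False, of ?P i] q(2) q0 by simp
  qed
  then have "(LINT y|lborel. (k' (g y) * partial i g y) *\<^sub>R q y + k (g y) *\<^sub>R partial i q y) = 0"
    using integral_partial(2)[OF P compact_cball, of x0 "2 * r" i] q(2) by simp
  then show "(LINT y|lborel. (k' (g y) * partial i g y) *\<^sub>R q y) = - (LINT y|lborel. k (g y) *\<^sub>R partial i q y)"
    using i1 i2 by (simp add: eq_neg_iff_add_eq_0)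
qed

text \<open>Applied to \<open>k(t) = \<eta>(t/\<epsilon>)\<close>, this bounds the volume of the layer \<open>\<bar>g\<bar> < \<epsilon>\<close> by \<open>O(\<epsilon>)\<close>.\<close>

lemma layer_mass:
  obtains C where "C \<ge> 0"
    and "\<And>k k' b. (\<And>t. (k has_real_derivative k' t) (at t)) \<Longrightarrow> continuous_on UNIV k' \<Longrightarrow>
      (\<And>t. 0 \<le> k' t) \<Longrightarrow> (\<And>t. \<bar>k t\<bar> \<le> b) \<Longrightarrow>
      integrable lborel (\<lambda>y. indicator (cball x0 r) y * k' (g y)) \<and>
      (LINT y|lborel. indicator (cball x0 r) y * k' (g y)) \<le> b * C"
proof
  let ?\<beta> = "bump x0 (2 * r)"
  have \<beta>: "C1_on UNIV ?\<beta>" "y \<notin> cball x0 (2 * r) \<Longrightarrow> ?\<beta> y = 0" for y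
    using r by (auto intro: C1_on_bump bump_0)
  have int\<beta>: "integrable lborel (partial i ?\<beta>)"
    by (rule integral_partial(1)[OF \<beta>(1) compact_cball \<beta>(2)])
  \<comment> \<open>\<open>C\<close> depends on the bump and the slope but not on \<open>k\<close>;
    this uniformity admits layers of vanishing thickness.\<close>
  define C where "C = (LINT y|lborel. \<bar>partial i ?\<beta> y\<bar>) / c"
  show "C \<ge> 0" using c by (simp add: C_def)
  fix k k' :: "real \<Rightarrow> real" and b
  assume k: "\<And>t. (k has_real_derivative k' t) (at t)" "continuous_on UNIV k'"
    "\<And>t. 0 \<le> k' t" "\<And>t. \<bar>k t\<bar> \<le> b"
  note ch = chain[OF \<beta> k(1,2)]
  have "continuous_on (cball x0 r) g"
    using continuous_g small_ball_U continuous_on_subset by blast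
  then have "continuous_on (cball x0 r) (\<lambda>y. k' (g y))"
    by (intro continuous_on_compose2[OF k(2)]) auto
  from borel_integrable_compact[OF compact_cball this]
  have int: "integrable lborel (\<lambda>y. indicator (cball x0 r) y * k' (g y))" by simp
  \<comment> \<open>On the inner ball the bump is 1 and the signed slope is at least
    \<open>c\<close>. Elsewhere the left side is 0, and the right side is nonnegative because k'
    is.\<close>
  have pt: "c * (indicator (cball x0 r) y * k' (g y)) \<le> s * ((k' (g y) * partial i g y) *\<^sub>R ?\<beta> y)" for y
  proof (cases "y \<in> cball x0 (2 * r)")
    case True
    have "c * (indicator (cball x0 r) y * k' (g y)) \<le> (s * partial i g y) * (?\<beta> y * k' (g y))"
      using transversal[OF True] c k(3)[of "g y"] bump_1[of "2 * r" x0 y] bump_bounds[of x0 "2 * r" y] r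
      by (intro mult_mono mult_right_mono) (auto simp: indicator_def)
    then show ?thesis by (simp add: mult_ac)
  next
    case False
    then show ?thesis using \<beta>(2) r by (auto simp: indicator_def)
  qed
  have "c * (LINT y|lborel. indicator (cball x0 r) y * k' (g y))
      = (LINT y|lborel. c * (indicator (cball x0 r) y * k' (g y)))" by simp
  also have "\<dots> \<le> (LINT y|lborel. s * ((k' (g y) * partial i g y) *\<^sub>R ?\<beta> y))"
    using int ch(2) pt by (intro integral_mono) auto
  also have "\<dots> = - s * (LINT y|lborel. k (g y) *\<^sub>R partial i ?\<beta> y)" using ch(3) by simp
  also have "\<dots> \<le> \<bar>LINT y|lborel. k (g y) *\<^sub>R partial i ?\<beta> y\<bar>"
    using s by (auto simp: abs_if split: if_splits)
  also have "\<dots> \<le> (LINT y|lborel. \<bar>k (g y) *\<^sub>R partial i ?\<beta> y\<bar>)"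
    by (rule integral_abs_bound)
  also have "\<dots> \<le> (LINT y|lborel. b * \<bar>partial i ?\<beta> y\<bar>)"
    using integrable_abs[OF ch(1)] int\<beta> k(4) by (intro integral_mono) (auto simp: abs_mult intro: mult_right_mono)
  also have "\<dots> = c * (b * C)" using c by (simp add: C_def)
  finally have "(LINT y|lborel. indicator (cball x0 r) y * k' (g y)) \<le> b * C"
    using c by simp
  with int show "integrable lborel (\<lambda>y. indicator (cball x0 r) y * k' (g y)) \<and>
      (LINT y|lborel. indicator (cball x0 r) y * k' (g y)) \<le> b * C" by simp
qed

text \<open>The layer bound is applied to arctan (n t): its derivative at 0 is \<open>n\<close>, yet
  its modulus stays below pi / 2, so \<open>n\<close> times the volume of the zero set is bounded
  for all \<open>n\<close>. It is needed because the layer cutoffs tend to 1 only off the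
  surface.\<close>

lemma AE_off_surface: "AE y in lborel. y \<in> cball x0 r \<longrightarrow> g y \<noteq> 0"
proof -
  obtain C where C: "C \<ge> 0"
    "\<And>k k' b. (\<And>t. (k has_real_derivative k' t) (at t)) \<Longrightarrow> continuous_on UNIV k' \<Longrightarrow>
      (\<And>t. 0 \<le> k' t) \<Longrightarrow> (\<And>t. \<bar>k t\<bar> \<le> b) \<Longrightarrow>
      integrable lborel (\<lambda>y. indicator (cball x0 r) y * k' (g y)) \<and>
      (LINT y|lborel. indicator (cball x0 r) y * k' (g y)) \<le> b * C"
    using layer_mass by blast
  let ?Z = "{y \<in> cball x0 r. g y = 0}"
  have cg: "continuous_on (cball x0 r) g"
    using continuous_g small_ball_U continuous_on_subset by blast
  have "closed ?Z"
    using continuous_closed_preimage[OF cg closed_cball, of "{0}"] by (simp add: vimage_def Int_def)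
  moreover have "bounded ?Z" by (rule bounded_subset[OF bounded_cball[of x0 r]]) auto
  ultimately have Z: "compact ?Z" by (simp add: compact_eq_bounded_closed)
  have "real n * measure lborel ?Z \<le> pi / 2 * C" for n
  proof -
    let ?k = "\<lambda>t. arctan (real n * t)" and ?k' = "\<lambda>t. real n * inverse (1 + (real n * t)\<^sup>2)"
    have d: "(?k has_real_derivative ?k' t) (at t)" for t
      by (auto intro!: derivative_eq_intros)
    have "continuous_on UNIV ?k'"
      by (intro continuous_intros ballI less_imp_neq[symmetric] add_pos_nonneg) auto
    moreover have "\<bar>?k t\<bar> \<le> pi / 2" for t using arctan_bounded[of "real n * t"] by (auto simp: abs_le_iff)
    ultimately have I: "integrable lborel (\<lambda>y. indicator (cball x0 r) y * ?k' (g y))"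
      "(LINT y|lborel. indicator (cball x0 r) y * ?k' (g y)) \<le> pi / 2 * C"
      using C(2)[of ?k ?k' "pi / 2", OF d] by auto
    have "real n * measure lborel ?Z = (LINT y|lborel. real n * indicator ?Z y)"
      using Z by simp
    also have "\<dots> \<le> (LINT y|lborel. indicator (cball x0 r) y * ?k' (g y))"
    proof (rule integral_mono[OF _ I(1)])
      show "integrable lborel (\<lambda>y. real n * indicator ?Z y)"
        using emeasure_compact_finite[OF Z] borel_compact[OF Z]
        by (intro integrable_mult_right integrable_real_indicator) auto
    qed (auto simp: indicator_def)
    finally show ?thesis using I(2) by linarith
  qed
  then have "measure lborel ?Z \<le> 0"
    using reals_Archimedean3[of "measure lborel ?Z"] by (meson leD not_le_imp_less)
  then have "emeasure lborel ?Z = 0"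
    using emeasure_compact_finite[OF Z]
    by (simp add: emeasure_eq_ennreal_measure measure_le_0_iff)
  then have "?Z \<in> null_sets lborel" using borel_compact[OF Z] by (intro null_setsI) auto
  then show ?thesis by (rule AE_I') auto
qed

end

text \<open>An odd nondecreasing transition from -1 to 1 that is 0 on [-1, 1]. The cutoff is its
  square. The square is not monotone, so \<open>layer_mass\<close> is applied to
  \<open>layer\<close>, whose derivative dominates that of the square up to a factor 2.\<close>

definition layer :: "real \<Rightarrow> real" where
  "layer t = step (t - 1) - step (- t - 1)"

definition layer' :: "real \<Rightarrow> real" where
  "layer' t = step' (t - 1) + step' (- t - 1)"

lemma layer_has_derivative: "(layer has_real_derivative layer' t) (at t)"
proof -
  have 1: "((\<lambda>t::real. t - 1) has_real_derivative 1) (at t)"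
    and 2: "((\<lambda>t::real. - t - 1) has_real_derivative -1) (at t)" by (auto intro!: derivative_eq_intros)
  show ?thesis
    using DERIV_diff[OF DERIV_chain2[OF step_has_derivative 1] DERIV_chain2[OF step_has_derivative 2]]
    by (simp add: layer_def[abs_def] layer'_def)
qed

lemma layer'_continuous: "continuous_on UNIV layer'"
  unfolding layer'_def[abs_def]
  by (intro continuous_intros continuous_on_compose2[OF step'_continuous]) auto

lemma layer'_nonneg: "layer' t \<ge> 0"
  by (simp add: layer'_def step'_nonneg)

lemma layer_bound: "\<bar>layer t\<bar> \<le> 1"
  using step_bounds[of "t - 1"] step_bounds[of "- t - 1"] by (simp add: layer_def)

lemma layer_0: "\<bar>t\<bar> \<le> 1 \<Longrightarrow> layer t = 0"
  by (auto simp: layer_def step_values)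

lemma layer_1: "\<bar>t\<bar> \<ge> 2 \<Longrightarrow> (layer t)\<^sup>2 = 1"
  by (auto simp: layer_def step_values abs_if split: if_splits)

context boundary_patch
begin

text \<open>A field whose normal component is continuous across the surface \<open>g = 0\<close> has no
  surface contribution to its weak divergence. The cutoff \<open>\<kappa> n\<close> kills the layer
  \<open>\<bar>g\<bar> < 1/(n + 1)\<close>; its gradient is odd across the surface, so the boundary term disappears in the
  limit for \<open>C\<^sup>1\<close> densities, and for continuous ones by approximation.\<close>

lemma weak_divergence:
  fixes F :: "real^3 \<Rightarrow> complex^3" and D N :: "real^3 \<Rightarrow> complex"
  assumes F: "C1_on {y \<in> U. g y \<noteq> 0} F" "\<And>y. y \<in> U \<Longrightarrow> g y \<noteq> 0 \<Longrightarrow> divergence F y = D y"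
    and zero: "\<And>y. y \<in> U \<Longrightarrow> g y = 0 \<Longrightarrow> F y = 0" "\<And>y. y \<in> U \<Longrightarrow> g y = 0 \<Longrightarrow> D y = 0"
    and bound: "\<And>y. y \<in> U \<Longrightarrow> norm (F y) \<le> C" "\<And>y. y \<in> U \<Longrightarrow> norm (D y) \<le> C"
    and N: "continuous_on U N" "\<And>y. y \<in> U \<Longrightarrow> g y \<noteq> 0 \<Longrightarrow> N y = cvec (grad g y) \<bullet>\<^sub>c F y"
    and \<phi>: "C1_on UNIV \<phi>" "\<And>y. y \<notin> cball x0 r \<Longrightarrow> \<phi> y = 0"
  shows "integrable lborel (\<lambda>y. cvec (grad \<phi> y) \<bullet>\<^sub>c F y + \<phi> y *\<^sub>R D y)"
    and "(LINT y|lborel. cvec (grad \<phi> y) \<bullet>\<^sub>c F y + \<phi> y *\<^sub>R D y) = 0"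
proof -
  let ?K = "cball x0 r"
  define X where "X y = cvec (grad \<phi> y) \<bullet>\<^sub>c F y + \<phi> y *\<^sub>R D y" for y
  define \<kappa> where "\<kappa> n t = (layer (real (Suc n) * t))\<^sup>2" for n t
  define \<kappa>' where "\<kappa>' n t = 2 * layer (real (Suc n) * t) * (real (Suc n) * layer' (real (Suc n) * t))" for n t
  have sub: "continuous_on U f \<Longrightarrow> continuous_on ?K f" for f :: "real^3 \<Rightarrow> 'z::topological_space"
    using small_ball_U continuous_on_subset by blast
  have grad0: "grad \<phi> y = 0" if "y \<notin> ?K" for y
    by (rule grad_zero_outside[OF closed_cball \<phi>(2) that])
  have cphi: "continuous_on T \<phi>" "continuous_on T (grad \<phi>)" for T
    using C1_on_continuous[OF \<phi>(1)] grad_continuous[OF \<phi>(1)] by (auto intro: continuous_on_subset)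
  have cg: "continuous_on ?K g" by (rule sub[OF continuous_g])
  have clayer: "continuous_on UNIV layer"
    by (rule DERIV_continuous_on[of UNIV layer layer']) (simp add: layer_has_derivative)
  have dk: "(\<kappa> n has_real_derivative \<kappa>' n t) (at t)"
    and de: "((\<lambda>t. layer (real (Suc n) * t)) has_real_derivative (real (Suc n) * layer' (real (Suc n) * t))) (at t)" for n t
  proof -
    have "((\<lambda>t. real (Suc n) * t) has_real_derivative real (Suc n)) (at t)" by (auto intro!: derivative_eq_intros)
    from DERIV_chain2[OF layer_has_derivative this]
    show *: "((\<lambda>t. layer (real (Suc n) * t)) has_real_derivative (real (Suc n) * layer' (real (Suc n) * t))) (at t)"
      by (simp add: mult.commute)
    from DERIV_power[OF this, of 2]
    show "(\<kappa> n has_real_derivative \<kappa>' n t) (at t)"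
      unfolding \<kappa>_def[abs_def] \<kappa>'_def by (simp add: mult_ac)
  qed
  have cl': "continuous_on UNIV (\<lambda>t. real (Suc n) * layer' (real (Suc n) * t))" for n
    by (intro continuous_intros continuous_on_compose2[OF layer'_continuous]) auto
  have ck': "continuous_on UNIV (\<kappa>' n)" for n
    unfolding \<kappa>'_def[abs_def]
    by (intro continuous_on_mult continuous_on_const continuous_on_id
      continuous_on_compose2[OF clayer] continuous_on_compose2[OF layer'_continuous]) auto
  have k0: "\<kappa> n t = 0" "\<kappa>' n t = 0" if "\<bar>t\<bar> < 1 / real (Suc n)" for n t
  proof -
    have "real (Suc n) * \<bar>t\<bar> \<le> 1" using that by (simp add: field_simps)
    then have "\<bar>real (Suc n) * t\<bar> \<le> 1" by (simp only: abs_mult abs_of_nat)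
    then show "\<kappa> n t = 0" "\<kappa>' n t = 0" by (auto simp: \<kappa>_def \<kappa>'_def layer_0)
  qed
  have k_le: "\<bar>\<kappa> n t\<bar> \<le> 1" "\<bar>\<kappa> n t - 1\<bar> \<le> 1" for n t
    using layer_bound[of "real (Suc n) * t"] abs_square_le_1[of "layer (real (Suc n) * t)"]
    by (auto simp: \<kappa>_def)
  have k'_le: "\<bar>\<kappa>' n t\<bar> \<le> 2 * (real (Suc n) * layer' (real (Suc n) * t))" for n t
    using mult_right_mono[OF layer_bound[of "real (Suc n) * t"], of "2 * (real (Suc n) * layer' (real (Suc n) * t))"]
      layer'_nonneg[of "real (Suc n) * t"]
    by (simp add: \<kappa>'_def abs_mult mult_ac)
  have k_lim: "(\<lambda>n. \<kappa> n t) \<longlonglongrightarrow> 1" if t: "t \<noteq> 0" for t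
  proof (rule tendsto_eventually)
    obtain m where m: "real m * \<bar>t\<bar> > 2" using reals_Archimedean3[of "\<bar>t\<bar>"] t by auto
    show "\<forall>\<^sub>F n in sequentially. \<kappa> n t = 1"
    proof (rule eventually_sequentiallyI[of m])
      fix n assume "n \<ge> m"
      then have "real m * \<bar>t\<bar> \<le> real (Suc n) * \<bar>t\<bar>" by (intro mult_right_mono) auto
      with m show "\<kappa> n t = 1" unfolding \<kappa>_def by (intro layer_1) (auto simp: abs_mult)
    qed
  qed
  have X0: "X y = 0" if "y \<notin> ?K \<or> g y = 0" for y
    using that grad0[of y] \<phi>(2)[of y] zero[of y] small_ball_U
    by (cases "y \<in> ?K") (auto simp: X_def)
  have boundary_term: "integrable lborel (\<lambda>y. (\<phi> y * \<kappa>' n (g y)) *\<^sub>R N y)" for n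
    by (rule integrable_compact_support[of ?K])
      (auto intro!: continuous_intros cphi sub[OF N(1)] continuous_on_compose2[OF ck' cg] simp: \<phi>(2))
  \<comment> \<open>Gauss for \<phi> \<kappa>(g) F, which is C^1 everywhere because \<kappa>(g)
    vanishes near the surface, where \<open>F\<close> may jump. The derivative that falls on the
    cutoff leaves the boundary term, in which \<open>F\<close> occurs only through
    \<open>N\<close>.\<close>
  have cut: "integrable lborel (\<lambda>y. \<kappa> n (g y) *\<^sub>R X y)"
    "(LINT y|lborel. \<kappa> n (g y) *\<^sub>R X y) = - (LINT y|lborel. (\<phi> y * \<kappa>' n (g y)) *\<^sub>R N y)" for n
  proof -
    let ?f = "\<lambda>y. \<phi> y * \<kappa> n (g y)"
    let ?V = "\<lambda>y. ?f y *\<^sub>R F y"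
    let ?S = "{y \<in> U. g y \<noteq> 0}" and ?T = "{y \<in> U. \<bar>g y\<bar> < 1 / real (Suc n)}"
    have "?S = U \<inter> g -` (- {0})" "?T = U \<inter> (\<lambda>y. \<bar>g y\<bar>) -` {..<1 / real (Suc n)}" by auto
    then have opn: "open ?S" "open ?T"
      using continuous_open_preimage[OF continuous_g open_U, of "- {0}"]
        continuous_open_preimage[OF continuous_on_rabs[OF continuous_g] open_U, of "{..<1 / real (Suc n)}"]
      by auto
    have f: "C1_on U ?f"
      by (intro C1_on_mult C1_on_subset[OF \<phi>(1)] C1_on_comp_real[OF dk ck' C1_g]) auto
    have V0: "?V y = 0" if "y \<in> ?T" for y using that k0 by simp
    have "C1_on ((?S \<union> ?T) \<union> - ?K) ?V"
      by (intro C1_on_Un opn open_Un C1_on_scaleR C1_on_subset[OF f] F(1) C1_on_zero_open[of ?T]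
          C1_on_zero_open[of "- ?K"]) (auto simp: \<phi>(2) k0)
    moreover have "(?S \<union> ?T) \<union> - ?K = UNIV" using small_ball_U by auto
    ultimately have V: "C1_on UNIV ?V" by simp
    have div: "divergence ?V y = \<kappa> n (g y) *\<^sub>R X y + (\<phi> y * \<kappa>' n (g y)) *\<^sub>R N y" for y
    proof -
      consider "y \<in> ?S" | "y \<in> ?T" | "y \<notin> ?K" using small_ball_U by fastforce
      then show ?thesis
      proof cases
        case 1
        then have y: "y \<in> U" "g y \<noteq> 0" by auto
        have "partial i ?f y = \<phi> y * (\<kappa>' n (g y) * partial i g y) + partial i \<phi> y * \<kappa> n (g y)" for i
          using partial_bilinear[OF bounded_bilinear_mult C1_onD(1)[OF \<phi>(1) UNIV_I]
              differentiable_comp_real[OF dk C1_onD(1)[OF C1_g y(1)]]]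
            partial_comp_real[of "\<kappa> n" "\<kappa>' n" g, OF dk C1_onD(1)[OF C1_g y(1)]] by simp
        then have "grad ?f y = (\<phi> y * \<kappa>' n (g y)) *\<^sub>R grad g y + \<kappa> n (g y) *\<^sub>R grad \<phi> y"
          by (simp add: grad_def vec_eq_iff)
        moreover have "divergence ?V y = cvec (grad ?f y) \<bullet>\<^sub>c F y + ?f y *\<^sub>R divergence F y"
          by (rule divergence_scaleR[OF C1_onD(1)[OF f y(1)] C1_onD(1)[OF F(1) 1]])
        ultimately show ?thesis
          using F(2)[OF y] N(2)[OF y]
          by (simp add: X_def
            bounded_bilinear.add_left[OF bounded_bilinear_cdot] bounded_bilinear.scaleR_left[OF bounded_bilinear_cdot]
            algebra_simps)
      next
        case 2
        have "divergence ?V y = divergence (\<lambda>_. 0) y"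
          by (rule divergence_cong_open[OF opn(2) 2 V0])
        then show ?thesis using 2 k0 by (simp add: divergence_def partial_const)
      next
        case 3
        then show ?thesis
          using divergence_zero_outside[of ?K ?V y] X0[of y] by (simp add: \<phi>(2))
      qed
    qed
    have V0: "?V y = 0" if "y \<notin> ?K" for y using that by (simp add: \<phi>(2))
    note I = integral_divergence[OF V compact_cball V0, unfolded div[abs_def]]
    from Bochner_Integration.integrable_diff[OF I(1) boundary_term[of n]]
    show i: "integrable lborel (\<lambda>y. \<kappa> n (g y) *\<^sub>R X y)" by simp
    show "(LINT y|lborel. \<kappa> n (g y) *\<^sub>R X y) = - (LINT y|lborel. (\<phi> y * \<kappa>' n (g y)) *\<^sub>R N y)"
      using I(2) i boundary_term[of n] by (simp add: eq_neg_iff_add_eq_0)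
  qed
  obtain B where B: "\<And>a b. norm (a \<bullet>\<^sub>c b) \<le> norm a * norm b * B" "B > 0"
    using bounded_bilinear.pos_bounded[OF bounded_bilinear_cdot] by blast
  \<comment> \<open>A bound independent of \<open>n\<close>; this is where boundedness of
    \<open>F\<close> and \<open>D\<close> up to the surface enters.\<close>
  define w where "w y = norm (cvec (grad \<phi> y)) * \<bar>C\<bar> * B + \<bar>\<phi> y\<bar> * \<bar>C\<bar>" for y
  have w: "integrable lborel w"
    unfolding w_def using grad0 \<phi>(2)
    by (intro integrable_compact_support[of ?K])
     (auto intro!: continuous_intros cphi continuous_on_compose2[OF linear_continuous_on[OF bounded_linear_cvec]])
  have wX: "norm (X y) \<le> w y" for y
  proof (cases "y \<in> ?K")
    case True
    then have y: "y \<in> U" using small_ball_U by auto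
    have "norm (X y) \<le> norm (cvec (grad \<phi> y) \<bullet>\<^sub>c F y) + norm (\<phi> y *\<^sub>R D y)"
      unfolding X_def by (rule norm_triangle_ineq)
    also have "\<dots> \<le> norm (cvec (grad \<phi> y)) * norm (F y) * B + \<bar>\<phi> y\<bar> * norm (D y)"
      using B(1) by (intro add_mono) auto
    also have "\<dots> \<le> w y" unfolding w_def using bound[OF y] B(2)
      by (intro add_mono mult_right_mono mult_left_mono) auto
    finally show ?thesis .
  next
    case False
    then show ?thesis using X0 B by (simp add: w_def)
  qed
  have lim: "(\<lambda>n. \<kappa> n (g y) *\<^sub>R X y) \<longlonglongrightarrow> X y" for y
  proof (cases "g y = 0")
    case True then show ?thesis using X0 by simp
  next
    case False
    then show ?thesis using tendsto_scaleR[OF k_lim tendsto_const, of "g y" "X y"] by simp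
  qed
  have Xm: "X \<in> borel_measurable lborel"
    by (rule borel_measurable_LIMSEQ_metric[OF borel_measurable_integrable[OF cut(1)] lim])
  have wn: "norm (\<kappa> n (g y) *\<^sub>R X y) \<le> w y" for n y
    using mult_mono[OF k_le(1)[of n "g y"] wX[of y]] by simp
  have Xi: "integrable lborel X"
    by (rule integrable_dominated_convergence[where s="\<lambda>n y. \<kappa> n (g y) *\<^sub>R X y" and w=w])
      (use Xm borel_measurable_integrable[OF cut(1)] w lim wn in auto)
  have Xlim: "(\<lambda>n. LINT y|lborel. \<kappa> n (g y) *\<^sub>R X y) \<longlonglongrightarrow> (LINT y|lborel. X y)"
    by (rule integral_dominated_convergence[where w=w])
      (use Xm borel_measurable_integrable[OF cut(1)] w lim wn in auto)
  obtain M where M: "M \<ge> 0"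
    "\<And>k k' b. (\<And>t. (k has_real_derivative k' t) (at t)) \<Longrightarrow> continuous_on UNIV k' \<Longrightarrow>
      (\<And>t. 0 \<le> k' t) \<Longrightarrow> (\<And>t. \<bar>k t\<bar> \<le> b) \<Longrightarrow>
      integrable lborel (\<lambda>y. indicator (cball x0 r) y * k' (g y)) \<and>
      (LINT y|lborel. indicator (cball x0 r) y * k' (g y)) \<le> b * M"
    using layer_mass by blast
  have gi_cont: "continuous_on ?K (partial i g)"
    using C1_g by (intro sub) (auto simp: C1_on_def)
  have gi: "partial i g y \<noteq> 0" if "y \<in> ?K" for y
    using transversal[of y] c r that by (auto)
  have "bounded (partial i g ` ?K)" "bounded (\<phi> ` ?K)"
    by (auto intro!: compact_imp_bounded compact_continuous_image gi_cont cphi)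
  then obtain L P where L: "L > 0" "\<And>y. y \<in> ?K \<Longrightarrow> \<bar>partial i g y\<bar> \<le> L"
    and P: "P > 0" "\<And>y. y \<in> ?K \<Longrightarrow> \<bar>\<phi> y\<bar> \<le> P"
    unfolding bounded_pos by (metis imageI real_norm_def)
  have small: "norm (LINT y|lborel. X y) \<le> e * (2 * P * L * M)" if e: "e > 0" for e
  proof -
    \<comment> \<open>Dividing by the slope first makes the density, up to \<open>e\<close>, the
      product of \<open>partial i g\<close> and a polynomial. To such densities \<open>chain\<close>
      applies exactly.\<close>
    have "continuous_on ?K (\<lambda>y. N y /\<^sub>R partial i g y)"
      by (intro continuous_intros gi_cont sub[OF N(1)]) (use gi in auto)
    from Stone_Weierstrass_polynomial_function[OF compact_cball this e]
    obtain p where p: "polynomial_function p" "\<And>y. y \<in> ?K \<Longrightarrow> norm (N y /\<^sub>R partial i g y - p y) < e" by auto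
    define q where "q y = \<phi> y *\<^sub>R p y" for y
    have q: "C1_on UNIV q"
      unfolding q_def[abs_def] by (intro C1_on_scaleR \<phi>(1) C1_on_polynomial p(1))
    have q0: "q y = 0" if "y \<notin> ?K" for y using that by (simp add: q_def \<phi>(2))
    have q0': "q y = 0" if "y \<notin> cball x0 (2 * r)" for y using that r by (intro q0) auto
    have dq0: "partial i q y = 0" if "y \<notin> ?K" for y
      by (rule partial_zero_outside[OF closed_cball q0 that])
    have dq: "integrable lborel (partial i q)"
      by (rule integral_partial(1)[OF q compact_cball q0])
    \<comment> \<open>Subtracting 1 leaves the derivative unchanged but makes the function produced
      by \<open>chain\<close> tend to 0 almost everywhere.\<close>
    have dk1: "((\<lambda>t. \<kappa> n t - 1) has_real_derivative \<kappa>' n t) (at t)" for n t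
      using DERIV_diff[OF dk DERIV_const] by simp
    note ch = chain[OF q q0' dk1 ck']
    define E where "E n = (LINT y|lborel. (\<kappa> n (g y) - 1) *\<^sub>R partial i q y)" for n
    have "E \<longlonglongrightarrow> (LINT y::real^3|lborel. 0 :: complex)"
      unfolding E_def
    proof (rule integral_dominated_convergence[where w="\<lambda>y. norm (partial i q y)"])
      show "AE y in lborel. (\<lambda>n. (\<kappa> n (g y) - 1) *\<^sub>R partial i q y) \<longlonglongrightarrow> 0"
        using AE_off_surface
      proof eventually_elim
        case (elim y)
        show ?case
        proof (cases "y \<in> ?K")
          case True
          then show ?thesis
            using tendsto_scaleR[OF tendsto_diff[OF k_lim tendsto_const] tendsto_const, of "g y" 1 "partial i q y"] elim
            by simp
        qed (simp add: dq0)
      qed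
      show "AE y in lborel. norm ((\<kappa> n (g y) - 1) *\<^sub>R partial i q y) \<le> norm (partial i q y)" for n
        using mult_right_mono[OF k_le(2) norm_ge_zero] by (intro AE_I2) (simp only: norm_scaleR mult_1)
    qed (use ch(1) dq in auto)
    then have E0: "E \<longlonglongrightarrow> 0" by simp
    \<comment> \<open>\<open>E n\<close> is the polynomial part. The approximation error contributes
      \<open>e\<close> times \<open>P\<close> for \<phi>, \<open>L\<close> for the slope, 2 from the
      derivative of the square, and the layer mass \<open>M\<close>. The latter does not depend on
      \<open>n\<close>, as the rescaled \<open>layer\<close> keeps the bound 1.\<close>
    have est: "norm (LINT y|lborel. \<kappa> n (g y) *\<^sub>R X y) \<le> norm (E n) + e * (2 * P * L * M)" for n
    proof -
      let ?e' = "\<lambda>t. real (Suc n) * layer' (real (Suc n) * t)"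
      let ?A = "\<lambda>y. (\<kappa>' n (g y) * partial i g y) *\<^sub>R q y"
      let ?R = "\<lambda>y. (\<phi> y * \<kappa>' n (g y)) *\<^sub>R N y - ?A y"
      have m: "integrable lborel (\<lambda>y. indicator ?K y * ?e' (g y))"
        "(LINT y|lborel. indicator ?K y * ?e' (g y)) \<le> 1 * M"
        using M(2)[OF de cl', of n 1] layer'_nonneg layer_bound by auto
      have R: "integrable lborel ?R" by (rule Bochner_Integration.integrable_diff[OF boundary_term ch(2)])
      have Rle: "norm (?R y) \<le> (e * (2 * P * L)) * (indicator ?K y * ?e' (g y))" for y
      proof (cases "y \<in> ?K")
        case True
        have "?R y = (\<phi> y * \<kappa>' n (g y) * partial i g y) *\<^sub>R (N y /\<^sub>R partial i g y - p y)"
          using gi[OF True] by (simp add: q_def scaleR_diff_right mult_ac)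
        then have "norm (?R y) = \<bar>\<phi> y\<bar> * \<bar>\<kappa>' n (g y)\<bar> * \<bar>partial i g y\<bar> * norm (N y /\<^sub>R partial i g y - p y)"
          by (simp only: norm_scaleR abs_mult)
        also have "\<dots> \<le> P * (2 * ?e' (g y)) * L * e"
          using P L p(2)[OF True] k'_le True by (intro mult_mono) (auto simp: layer'_nonneg intro: less_imp_le)
        finally show ?thesis using True by (simp add: mult_ac)
      qed (simp add: \<phi>(2) q0)
      have "(LINT y|lborel. (\<phi> y * \<kappa>' n (g y)) *\<^sub>R N y) = (LINT y|lborel. ?A y) + (LINT y|lborel. ?R y)"
        using boundary_term[of n] ch(2)[of n] by simp
      then have "(LINT y|lborel. \<kappa> n (g y) *\<^sub>R X y) = E n - (LINT y|lborel. ?R y)"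
        using ch(3)[of n] cut(2)[of n] by (simp add: E_def)
      moreover have "norm (LINT y|lborel. ?R y) \<le> (LINT y|lborel. (e * (2 * P * L)) * (indicator ?K y * ?e' (g y)))"
        using Rle m(1) by (intro Bochner_Integration.integral_norm_bound_integral R integrable_mult_right) auto
      moreover have "\<dots> = (e * (2 * P * L)) * (LINT y|lborel. indicator ?K y * ?e' (g y))" by simp
      moreover have "\<dots> \<le> (e * (2 * P * L)) * M"
        using m(2) e P(1) L(1) by (intro mult_left_mono) auto
      ultimately show ?thesis
        using norm_triangle_ineq4[of "E n" "LINT y|lborel. ?R y"] by (simp add: mult_ac)
    qed
    have "norm (LINT y|lborel. X y) \<le> norm (0::complex) + e * (2 * P * L * M)"
      by (rule tendsto_le[OF sequentially_bot tendsto_add[OF tendsto_norm[OF E0] tendsto_const] tendsto_norm[OF Xlim]])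
        (use est in auto)
    then show ?thesis by simp
  qed
  have "norm (LINT y|lborel. X y) \<le> 0"
  proof (rule field_le_epsilon)
    fix e :: real assume "e > 0"
    show "norm (LINT y|lborel. X y) \<le> 0 + e"
    proof (cases "M = 0")
      case True then show ?thesis using small[OF \<open>e > 0\<close>] \<open>e > 0\<close> by simp
    next
      case False
      then have pos: "2 * P * L * M > 0" using M P L by simp
      from small[OF divide_pos_pos[OF \<open>e > 0\<close> pos]] show ?thesis
        by (subst (asm) nonzero_eq_divide_eq[THEN iffD1, OF less_imp_neq[OF pos, symmetric] refl]) simp
    qed
  qed
  then show "(LINT y|lborel. cvec (grad \<phi> y) \<bullet>\<^sub>c F y + \<phi> y *\<^sub>R D y) = 0" by (simp add: X_def)
  show "integrable lborel (\<lambda>y. cvec (grad \<phi> y) \<bullet>\<^sub>c F y + \<phi> y *\<^sub>R D y)"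
    using Xi by (simp add: X_def[abs_def])
qed

end

section \<open>Localisation and decay at infinity\<close>

text \<open>Expresses that \<open>D\<close> is the distributional divergence of \<open>F\<close>,
  tested against \<phi>. Integrability is included because the integral of a nonintegrable function
  is 0 by default.\<close>

definition weak_identity :: "(real^3 \<Rightarrow> complex^3) \<Rightarrow> (real^3 \<Rightarrow> complex) \<Rightarrow> (real^3 \<Rightarrow> real) \<Rightarrow> bool" where
  "weak_identity F D \<phi> \<longleftrightarrow>
     integrable lborel (\<lambda>y. cvec (grad \<phi> y) \<bullet>\<^sub>c F y + \<phi> y *\<^sub>R D y) \<and>
     (LINT y|lborel. cvec (grad \<phi> y) \<bullet>\<^sub>c F y + \<phi> y *\<^sub>R D y) = 0"

lemma weak_identity_add:
  assumes "C1_on UNIV \<phi>" "C1_on UNIV \<psi>" "weak_identity F D \<phi>" "weak_identity F D \<psi>"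
  shows "weak_identity F D (\<lambda>y. \<phi> y + \<psi> y)"
proof -
  have "grad (\<lambda>y. \<phi> y + \<psi> y) y = grad \<phi> y + grad \<psi> y" for y
    using assms(1,2) by (simp add: grad_def vec_eq_iff partial_add C1_on_def)
  then have "cvec (grad (\<lambda>y. \<phi> y + \<psi> y) y) \<bullet>\<^sub>c F y + (\<phi> y + \<psi> y) *\<^sub>R D y
     = (cvec (grad \<phi> y) \<bullet>\<^sub>c F y + \<phi> y *\<^sub>R D y) + (cvec (grad \<psi> y) \<bullet>\<^sub>c F y + \<psi> y *\<^sub>R D y)" for y
    by (simp add: bounded_bilinear.add_left[OF bounded_bilinear_cdot] scaleR_add_left)
  then show ?thesis using assms(3,4) unfolding weak_identity_def by simp
qed

lemma weak_identity_smooth: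
  assumes S: "open S" "cball x r \<subseteq> S" and F: "C1_on S F" "\<And>y. y \<in> S \<Longrightarrow> divergence F y = D y"
    and \<phi>: "C1_on UNIV \<phi>" "\<And>y. y \<notin> cball x r \<Longrightarrow> \<phi> y = 0"
  shows "weak_identity F D \<phi>"
proof -
  let ?V = "\<lambda>y. \<phi> y *\<^sub>R F y"
  have "C1_on (S \<union> - cball x r) ?V"
    by (intro C1_on_Un S C1_on_scaleR C1_on_subset[OF \<phi>(1)] F C1_on_zero_open) (auto simp: \<phi>(2))
  moreover have "S \<union> - cball x r = UNIV" using S by auto
  ultimately have V: "C1_on UNIV ?V" by simp
  have V0: "?V y = 0" if "y \<notin> cball x r" for y using \<phi>(2)[OF that] by simp
  have "divergence ?V y = cvec (grad \<phi> y) \<bullet>\<^sub>c F y + \<phi> y *\<^sub>R D y" for y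
  proof (cases "y \<in> cball x r")
    case True
    then have y: "y \<in> S" using S by auto
    show ?thesis
      using divergence_scaleR[OF C1_onD(1)[OF \<phi>(1) UNIV_I] C1_onD(1)[OF F(1) y]] F(2)[OF y] by simp
  next
    case False
    then show ?thesis
      using divergence_zero_outside[OF closed_cball V0 False] grad_zero_outside[OF closed_cball \<phi>(2) False] \<phi>(2)
      by simp
  qed
  then have "divergence ?V = (\<lambda>y. cvec (grad \<phi> y) \<bullet>\<^sub>c F y + \<phi> y *\<^sub>R D y)" by (rule ext)
  moreover have "integrable lborel (divergence ?V)" "(LINT y|lborel. divergence ?V y) = 0"
    using integral_divergence[OF V compact_cball[of x r]] V0 by blast+
  ultimately show ?thesis by (simp only: weak_identity_def)
qed

text \<open>A partition of unity by peeling: for one centre at a time, \<psi> splits into p \<psi>,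
  supported in one admissible ball, and (1 - p) \<psi>, which vanishes on the ball of half the
  radius, where p = 1. Hence the cover by balls of half the admissible radius.\<close>

lemma weak_identity_global:
  assumes loc: "\<And>x. \<exists>r>0. \<forall>\<phi>. C1_on UNIV \<phi> \<longrightarrow> (\<forall>y. y \<notin> cball x r \<longrightarrow> \<phi> y = 0) \<longrightarrow> weak_identity F D \<phi>"
    and \<phi>: "C1_on UNIV \<phi>" "compact K" "\<And>y. y \<notin> K \<Longrightarrow> \<phi> y = 0"
  shows "weak_identity F D \<phi>"
proof -
  obtain \<rho> where \<rho>: "\<And>x. \<rho> x > 0"
    "\<And>x \<phi>. C1_on UNIV \<phi> \<Longrightarrow> (\<And>y. y \<notin> cball x (\<rho> x) \<Longrightarrow> \<phi> y = 0) \<Longrightarrow> weak_identity F D \<phi>"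
    using loc by metis
  have "K \<subseteq> (\<Union>x\<in>UNIV. ball x (\<rho> x / 2))" using \<rho>(1) by (meson UNIV_I UN_I centre_in_ball half_gt_zero subsetI)
  then obtain I where I: "finite I" "K \<subseteq> (\<Union>x\<in>I. ball x (\<rho> x / 2))"
    using compactE_image[OF \<phi>(2), of UNIV "\<lambda>x. ball x (\<rho> x / 2)"] by auto
  have "weak_identity F D \<psi>"
    if "C1_on UNIV \<psi>" "\<And>y. \<psi> y \<noteq> 0 \<Longrightarrow> y \<in> (\<Union>x\<in>I. ball x (\<rho> x / 2))" for \<psi>
    using I(1) that
  proof (induction I arbitrary: \<psi> rule: finite_induct)
    case empty
    then have "\<psi> = (\<lambda>_. 0)" by auto
    moreover have "grad (\<lambda>_. 0) y = 0" for y by (simp add: grad_def partial_const vec_eq_iff)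
    ultimately show ?case by (simp add: weak_identity_def)
  next
    case (insert x I)
    let ?p = "bump x (\<rho> x)"
    have C: "C1_on UNIV (\<lambda>y. ?p y * \<psi> y)" "C1_on UNIV (\<lambda>y. (1 - ?p y) * \<psi> y)"
      by (intro C1_on_mult C1_on_diff C1_on_const C1_on_bump insert.prems(1))+
    have "weak_identity F D (\<lambda>y. ?p y * \<psi> y)"
      by (rule \<rho>(2)[OF C(1), of x]) (use \<rho>(1) in \<open>auto simp: bump_0\<close>)
    moreover have "weak_identity F D (\<lambda>y. (1 - ?p y) * \<psi> y)"
    proof (rule insert.IH[OF C(2)])
      fix y assume y: "(1 - ?p y) * \<psi> y \<noteq> 0"
      then have "\<not> dist x y \<le> \<rho> x / 2" using bump_1[OF \<rho>(1)] by fastforce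
      with y insert.prems(2)[of y] show "y \<in> (\<Union>x\<in>I. ball x (\<rho> x / 2))" by auto
    qed
    ultimately have "weak_identity F D (\<lambda>y. ?p y * \<psi> y + (1 - ?p y) * \<psi> y)"
      by (rule weak_identity_add[OF C])
    then show ?case by (simp add: algebra_simps)
  qed
  then show ?thesis using \<phi>(1,3) I(2) by blast
qed

section \<open>Energy estimate and decay at infinity\<close>

definition conj_vec :: "complex^3 \<Rightarrow> complex^3" where
  "conj_vec a = (\<chi> i. cnj (a $ i))"

lemma bounded_linear_conj_vec: "bounded_linear conj_vec"
  unfolding linear_conv_bounded_linear[symmetric]
  by (auto intro!: linearI simp: conj_vec_def vec_eq_iff)

lemma curl_conj_vec:
  "F differentiable (at x) \<Longrightarrow> curl (\<lambda>y. conj_vec (F y)) x = conj_vec (curl F x)"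
  by (simp add: vec_eq_iff forall_3 curl_nth partial_linear[OF bounded_linear_conj_vec])
    (simp add: conj_vec_def curl_nth)

lemma norm_conj_vec [simp]: "norm (conj_vec a) = norm a"
  by (simp add: conj_vec_def norm_vec_def)

text \<open>The product is bilinear, so positivity of the energy has to come from an explicit
  conjugate.\<close>

lemma conj_vec_cdot: "conj_vec a \<bullet>\<^sub>c a = of_real ((norm a)\<^sup>2)"
proof -
  have "conj_vec a \<bullet>\<^sub>c a = (\<Sum>i\<in>UNIV. of_real ((norm (a $ i))\<^sup>2))"
    by (simp add: cdot_def conj_vec_def complex_norm_square mult.commute del: of_real_power)
  also have "\<dots> = of_real (\<Sum>i\<in>UNIV. (norm (a $ i))\<^sup>2)" by simp
  also have "(\<Sum>i\<in>UNIV. (norm (a $ i))\<^sup>2) = (norm a)\<^sup>2"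
    by (simp add: norm_vec_def L2_set_def sum_nonneg)
  finally show ?thesis .
qed

text \<open>One constant for the three operations together. Its value is immaterial, since only the
  power of R counts in the end.\<close>

lemma triple_bound: "\<exists>B>0. \<forall>w a b. norm (cvec w \<bullet>\<^sub>c (a \<times>\<^sub>c b)) \<le> B * norm w * norm a * norm b"
proof -
  obtain B1 where B1: "B1 > 0" "\<And>a b. norm (a \<bullet>\<^sub>c b) \<le> norm a * norm b * B1"
    using bounded_bilinear.pos_bounded[OF bounded_bilinear_cdot] by blast
  obtain B2 where B2: "B2 > 0" "\<And>a b. norm (a \<times>\<^sub>c b) \<le> norm a * norm b * B2"
    using bounded_bilinear.pos_bounded[OF bounded_bilinear_ccross] by blast
  obtain B3 where B3: "B3 > 0" "\<And>a. norm (cvec a) \<le> norm a * B3"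
    using bounded_linear.pos_bounded[OF bounded_linear_cvec] by blast
  have "norm (cvec w \<bullet>\<^sub>c (a \<times>\<^sub>c b)) \<le> (B1 * B2 * B3) * norm w * norm a * norm b" for w a b
  proof -
    have "norm (cvec w \<bullet>\<^sub>c (a \<times>\<^sub>c b)) \<le> norm (cvec w) * norm (a \<times>\<^sub>c b) * B1" by (rule B1)
    also have "\<dots> \<le> (norm w * B3) * (norm a * norm b * B2) * B1"
      using B1 B2 B3 by (intro mult_right_mono mult_mono) auto
    finally show ?thesis by (simp add: mult_ac)
  qed
  then show ?thesis using B1 B2 B3 by (intro exI[of _ "B1 * B2 * B3"]) auto
qed

text \<open>Caccioppoli's inequality, from testing \<open>curl (curl \<theta>) = 0\<close> with \<open>\<psi>\<^sup>2\<close> times the conjugate of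
  \<open>\<theta>\<close>.\<close>

lemma caccioppoli:
  assumes B: "\<And>w a b. norm (cvec w \<bullet>\<^sub>c (a \<times>\<^sub>c b)) \<le> B * norm w * norm a * norm b"
    and S: "open S" "C2_on S \<theta>" "\<And>x. x \<in> S \<Longrightarrow> curl (curl \<theta>) x = 0"
    and \<psi>: "C1_on UNIV \<psi>" "compact K" "K \<subseteq> S" "\<And>x. x \<notin> K \<Longrightarrow> \<psi> x = 0"
  shows "integrable lborel (\<lambda>x. (\<psi> x)\<^sup>2 * (norm (curl \<theta> x))\<^sup>2)"
    and "(LINT x|lborel. (\<psi> x)\<^sup>2 * (norm (curl \<theta> x))\<^sup>2)
       \<le> 4 * B\<^sup>2 * (LINT x|lborel. (norm (grad \<psi> x))\<^sup>2 * (norm (\<theta> x))\<^sup>2)"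
proof -
  have \<theta>: "C1_on S \<theta>" using S(2) by (simp add: C2_on_def)
  have A: "C1_on S (curl \<theta>)" by (rule C1_on_curl[OF S(2)])
  have grad0: "grad \<psi> x = 0" if "x \<notin> K" for x
    by (rule grad_zero_outside[OF compact_imp_closed[OF \<psi>(2)] \<psi>(4) that])
  have cK: "continuous_on K \<theta>" "continuous_on K (curl \<theta>)" "continuous_on K \<psi>" "continuous_on K (grad \<psi>)"
    using C1_on_continuous[OF \<theta>] C1_on_continuous[OF A] C1_on_continuous[OF \<psi>(1)] grad_continuous[OF \<psi>(1)] \<psi>(3)
    by (auto intro: continuous_on_subset)
  let ?W = "\<lambda>x. conj_vec (\<theta> x) \<times>\<^sub>c curl \<theta> x"
  let ?g = "\<lambda>x. 2 * \<psi> x *\<^sub>R (cvec (grad \<psi> x) \<bullet>\<^sub>c ?W x)"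
  let ?E = "\<lambda>x. (\<psi> x)\<^sup>2 * (norm (curl \<theta> x))\<^sup>2" and ?G = "\<lambda>x. (norm (grad \<psi> x))\<^sup>2 * (norm (\<theta> x))\<^sup>2"
  show E: "integrable lborel ?E"
    by (rule integrable_compact_support[OF \<psi>(2)]) (auto intro!: continuous_intros cK simp: \<psi>(4))
  have G: "integrable lborel ?G"
    by (rule integrable_compact_support[OF \<psi>(2)]) (auto intro!: continuous_intros cK simp: grad0)
  have g: "integrable lborel ?g"
    by (rule integrable_compact_support[OF \<psi>(2)])
      (auto intro!: continuous_intros cK bounded_bilinear.continuous_on[OF bounded_bilinear_cdot]
        bounded_bilinear.continuous_on[OF bounded_bilinear_ccross]
        bounded_linear.continuous_on[OF bounded_linear_cvec] bounded_linear.continuous_on[OF bounded_linear_conj_vec]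
        simp: \<psi>(4))
  have W: "C1_on S ?W" by (intro C1_on_ccross C1_on_linear[OF bounded_linear_conj_vec] \<theta> A)
  let ?V = "\<lambda>x. (\<psi> x * \<psi> x) *\<^sub>R ?W x"
  have \<psi>2: "C1_on T (\<lambda>x. \<psi> x * \<psi> x)" for T by (intro C1_on_mult C1_on_subset[OF \<psi>(1)]) auto
  have "C1_on (S \<union> - K) ?V"
    by (intro C1_on_Un S open_Compl compact_imp_closed \<psi>(2) C1_on_scaleR \<psi>2 W C1_on_zero_open) (auto simp: \<psi>(4))
  moreover have "S \<union> - K = UNIV" using \<psi>(3) by auto
  ultimately have V: "C1_on UNIV ?V" by simp
  have V0: "?V x = 0" if "x \<notin> K" for x using \<psi>(4)[OF that] by simp
  \<comment> \<open>Of the two terms in the divergence of the cross product, the one with curl (curl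
    \<theta>) drops out, and the other is the square of the norm of curl \<theta>, because
    conjugation is real-linear and so commutes with \<open>curl\<close>.\<close>
  have div: "divergence ?V x = ?g x + of_real (?E x)" for x
  proof (cases "x \<in> K")
    case True
    then have x: "x \<in> S" using \<psi>(3) by auto
    have "grad (\<lambda>x. \<psi> x * \<psi> x) x = (2 * \<psi> x) *\<^sub>R grad \<psi> x"
      using partial_bilinear[OF bounded_bilinear_mult C1_onD(1)[OF \<psi>(1) UNIV_I] C1_onD(1)[OF \<psi>(1) UNIV_I]]
      by (simp add: grad_def vec_eq_iff)
    moreover have "divergence ?W x = of_real ((norm (curl \<theta> x))\<^sup>2)"
      using divergence_ccross[OF differentiable_linear[OF bounded_linear_conj_vec C1_onD(1)[OF \<theta> x]] C1_onD(1)[OF A x]]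
        curl_conj_vec[OF C1_onD(1)[OF \<theta> x]] S(3)[OF x] by (simp add: conj_vec_cdot)
    ultimately show ?thesis
      using divergence_scaleR[OF C1_onD(1)[OF \<psi>2 UNIV_I] C1_onD(1)[OF W x]]
      by (simp add: bounded_bilinear.scaleR_left[OF bounded_bilinear_cdot] power2_eq_square)
        (simp add: scaleR_conv_of_real)
  next
    case False
    then show ?thesis
      using divergence_zero_outside[OF compact_imp_closed[OF \<psi>(2)] V0 False] \<psi>(4) by simp
  qed
  have "(LINT x|lborel. ?g x) + of_real (LINT x|lborel. ?E x) = (LINT x|lborel. ?g x) + (LINT x|lborel. of_real (?E x))"
    by (simp only: integral_complex_of_real)
  also have "\<dots> = (LINT x|lborel. ?g x + of_real (?E x))"
    by (rule Bochner_Integration.integral_add[OF g integrable_of_real[OF E], symmetric])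
  also have "\<dots> = 0"
  proof -
    have "divergence ?V = (\<lambda>x. ?g x + of_real (?E x))" using div by (rule ext)
    moreover have "(LINT x|lborel. divergence ?V x) = 0"
      by (rule integral_divergence(2)[OF V \<psi>(2)]) (rule V0)
    ultimately show ?thesis by simp
  qed
  finally have "(LINT x|lborel. ?g x) = - of_real (LINT x|lborel. ?E x)"
    by (simp only: eq_neg_iff_add_eq_0)
  then have "norm (LINT x|lborel. ?g x) = \<bar>LINT x|lborel. ?E x\<bar>"
    by (simp only: norm_minus_cancel norm_of_real)
  then have "(LINT x|lborel. ?E x) \<le> norm (LINT x|lborel. ?g x)" by linarith
  also have "\<dots> \<le> (LINT x|lborel. 1/2 * ?E x + 2 * B\<^sup>2 * ?G x)"
  proof (rule Bochner_Integration.integral_norm_bound_integral[OF g])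
    show "integrable lborel (\<lambda>x. 1/2 * ?E x + 2 * B\<^sup>2 * ?G x)" using E G by auto
    fix x
    have "norm (?g x) \<le> 2 * \<bar>\<psi> x\<bar> * (B * norm (grad \<psi> x) * norm (conj_vec (\<theta> x)) * norm (curl \<theta> x))"
      using mult_left_mono[OF B, of "2 * \<bar>\<psi> x\<bar>" "grad \<psi> x" "conj_vec (\<theta> x)" "curl \<theta> x"] by (simp add: mult_ac)
    also have "\<dots> = 2 * (\<bar>\<psi> x\<bar> * norm (curl \<theta> x)) * (B * norm (grad \<psi> x) * norm (\<theta> x))" by simp
    \<comment> \<open>Young's inequality 2 a b \<le> a^2 / 2 + 2 b^2. Half of the energy is then
      absorbed on the left, which is legitimate as it is finite, and doubling gives the constant
      4.\<close>
    also have "\<dots> \<le> 1/2 * (\<bar>\<psi> x\<bar> * norm (curl \<theta> x))\<^sup>2 + 2 * (B * norm (grad \<psi> x) * norm (\<theta> x))\<^sup>2"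
      using zero_le_power2[of "\<bar>\<psi> x\<bar> * norm (curl \<theta> x) - 2 * (B * norm (grad \<psi> x) * norm (\<theta> x))"]
      unfolding power2_diff by (simp add: power2_eq_square)
    finally show "norm (?g x) \<le> 1/2 * ?E x + 2 * B\<^sup>2 * ?G x" by (simp add: power_mult_distrib mult_ac)
  qed
  also have "\<dots> = 1/2 * (LINT x|lborel. ?E x) + 2 * B\<^sup>2 * (LINT x|lborel. ?G x)" using E G by simp
  finally show "(LINT x|lborel. ?E x) \<le> 4 * B\<^sup>2 * (LINT x|lborel. ?G x)" by simp
qed

lemma integral_le_cball:
  fixes f :: "real^3 \<Rightarrow> real"
  assumes "integrable lborel f" "\<And>x. f x \<le> a * indicator (cball 0 \<rho>) x" "\<rho> \<ge> 0"
  shows "(LINT x|lborel. f x) \<le> a * (unit_ball_vol 3 * \<rho> ^ 3)"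
proof -
  have "(LINT x|lborel. f x) \<le> (LINT x::real^3|lborel. a * indicator (cball 0 \<rho>) x)"
  proof (rule integral_mono[OF assms(1)])
    show "integrable lborel (\<lambda>x::real^3. a * indicator (cball 0 \<rho>) x)"
      using emeasure_lborel_cball_finite[of "0::real^3" \<rho>]
      by (intro integrable_mult_right integrable_real_indicator) auto
  qed (rule assms(2))
  also have "\<dots> = a * measure lborel (cball (0::real^3) \<rho>)" by simp
  finally show ?thesis using content_cball[OF assms(3), of "0 :: real^3"] by (simp add: measure_completion)
qed

lemma grad_bump_inner:
  assumes "r > 0" "norm x < r / 2"
  shows "grad (bump 0 r) x = 0"
proof -
  have "partial i (bump 0 r) x = partial i (\<lambda>_. 1) x" for i
    using assms bump_1[of r 0] by (intro partial_cong_open[of "ball 0 (r / 2)"]) auto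
  then show ?thesis by (simp add: grad_def partial_const vec_eq_iff)
qed

text \<open>The gradient of the cutoff lives on R \<le> |x| \<le> 2 R. There Young's inequality
  separates the energy of curl \<theta>, controlled by \<open>caccioppoli\<close> on a wider
  annulus, from the square of the cutoff gradient times \<open>u\<close>. Both parts have the order
  R^-2 * R^-2 * R^3 = 1/R.\<close>

lemma far_field:
  assumes S: "open S" "C2_on S \<theta>" "\<And>x. x \<in> S \<Longrightarrow> curl (curl \<theta>) x = 0"
    and R0: "R0 > 0" "\<And>x. norm x \<ge> R0 \<Longrightarrow> x \<in> S"
    and u: "continuous_on S u"
    and decay: "\<And>x. norm x \<ge> R0 \<Longrightarrow> norm (\<theta> x) \<le> c / norm x" "\<And>x. norm x \<ge> R0 \<Longrightarrow> norm (u x) \<le> c / norm x"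
  shows "\<exists>C. \<forall>R\<ge>2 * R0. integrable lborel (\<lambda>x. cvec (grad (bump 0 (2 * R)) x) \<bullet>\<^sub>c (curl \<theta> x \<times>\<^sub>c u x)) \<and>
      norm (LINT x|lborel. cvec (grad (bump 0 (2 * R)) x) \<bullet>\<^sub>c (curl \<theta> x \<times>\<^sub>c u x)) \<le> C / R"
proof -
  obtain B where B: "B > 0" "\<And>w a b. norm (cvec w \<bullet>\<^sub>c (a \<times>\<^sub>c b)) \<le> B * norm w * norm a * norm b"
    using triple_bound by blast
  obtain M where M: "M > 0" "\<And>c r y. r > 0 \<Longrightarrow> norm (grad (bump c r) y) \<le> M / r"
    using grad_bump_bound by blast
  have "C1_on S \<theta>" using S(2) by (simp add: C2_on_def)
  note c\<theta> = C1_on_continuous[OF this] and cA = C1_on_continuous[OF C1_on_curl[OF S(2)]]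
  define \<Theta> where "\<Theta> = unit_ball_vol 3"
  have \<Theta>: "\<Theta> \<ge> 0" by (simp add: \<Theta>_def unit_ball_vol_nonneg)
  \<comment> \<open>1024 = 2^2 * 2^2 * 4^3: the squares of the bounds 2 M / R and 2 c / R,
    integrated over a ball of radius 4 R. For \<open>C2\<close> the bounds M / (2 R) and 2 c / R
    over radius 2 R give 8, and a factor B^2 / 4 is included.\<close>
  define C1 where "C1 = 1024 * M\<^sup>2 * c\<^sup>2 * \<Theta>"
  define C2 where "C2 = 2 * B\<^sup>2 * M\<^sup>2 * c\<^sup>2 * \<Theta>"
  have "integrable lborel (\<lambda>x. cvec (grad (bump 0 (2 * R)) x) \<bullet>\<^sub>c (curl \<theta> x \<times>\<^sub>c u x)) \<and>
      norm (LINT x|lborel. cvec (grad (bump 0 (2 * R)) x) \<bullet>\<^sub>c (curl \<theta> x \<times>\<^sub>c u x)) \<le> (2 * B\<^sup>2 * C1 + 2 * C2) / R"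
    if R: "R \<ge> 2 * R0" for R
  proof -
    have Rpos: "R > 0" "R / 2 \<ge> R0" using R R0 by auto
    let ?\<phi> = "bump (0::real^3) (2 * R)"
    \<comment> \<open>Equal to 1 on R \<le> |x| \<le> 2 R and supported in R / 2 \<le> |x| \<le> 4
      R. The inner radius explains the threshold \<open>2 * R0\<close>.\<close>
    let ?\<psi> = "\<lambda>x. bump 0 (4 * R) x * (1 - bump (0::real^3) R x)"
    let ?K = "cball 0 (4 * R) - ball (0::real^3) (R / 2)"
    have K: "compact ?K" by (intro compact_diff) auto
    have KS: "?K \<subseteq> S" using R0(2) Rpos by auto
    have \<psi>: "C1_on UNIV ?\<psi>" by (intro C1_on_mult C1_on_diff C1_on_const C1_on_bump)
    have \<psi>0: "?\<psi> x = 0" if "x \<notin> ?K" for x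
      using that Rpos bump_0[of "4 * R" 0 x] bump_1[of R 0 x] by auto
    have g\<psi>0: "grad ?\<psi> x = 0" if "x \<notin> ?K" for x
      by (rule grad_zero_outside[OF compact_imp_closed[OF K] \<psi>0 that])
    have g\<psi>: "norm (grad ?\<psi> x) \<le> 2 * M / R" for x
    proof -
      have "grad ?\<psi> x = bump 0 (4 * R) x *\<^sub>R (- grad (bump 0 R) x) + (1 - bump 0 R x) *\<^sub>R grad (bump 0 (4 * R)) x"
      proof -
        have d: "bump 0 r differentiable (at x)" for r by (rule C1_onD(1)[OF C1_on_bump UNIV_I])
        have "partial i (\<lambda>x. 1 - bump 0 R x) x = - partial i (bump 0 R) x" for i
          using partial_add[OF differentiable_const differentiable_linear[OF bounded_linear_minus[OF bounded_linear_ident] d], of i 1 R]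
            partial_linear[OF bounded_linear_minus[OF bounded_linear_ident] d, of i R] by (simp add: partial_const)
        then show ?thesis
          using partial_bilinear[OF bounded_bilinear_mult d differentiable_diff[OF differentiable_const d]]
          by (simp add: grad_def vec_eq_iff)
      qed
      also have "norm \<dots> \<le> \<bar>bump 0 (4 * R) x\<bar> * norm (grad (bump 0 R) x) + \<bar>1 - bump 0 R x\<bar> * norm (grad (bump 0 (4 * R)) x)"
        by (rule order_trans[OF norm_triangle_ineq]) simp
      also have "\<dots> \<le> 1 * (M / R) + 1 * (M / (4 * R))"
        using bump_bounds[of 0 R x] bump_bounds[of 0 "4 * R" x] Rpos M
        by (intro add_mono mult_mono) auto
      also have "\<dots> \<le> 2 * M / R" using M(1) Rpos(1) by (simp add: field_simps)
      finally show ?thesis .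
    qed
    have small: "norm (v x) \<le> 2 * c / R" if "x \<in> ?K" "\<And>x. norm x \<ge> R0 \<Longrightarrow> norm (v x) \<le> c / norm x"
      for x and v :: "real^3 \<Rightarrow> complex^3"
    proof -
      have x: "norm x \<ge> R / 2" using that(1) by auto
      have v: "norm (v x) \<le> c / norm x" by (rule that(2)) (use x Rpos in linarith)
      \<comment> \<open>The sign of \<open>c\<close> is read off from the decay bound itself, at a
        point of the annulus.\<close>
      then have "0 \<le> c / norm x" by (rule order_trans[OF norm_ge_zero])
      then have "0 \<le> c" using x Rpos by (auto simp: zero_le_divide_iff)
      then have "c / norm x \<le> c / (R / 2)" using x Rpos by (intro divide_left_mono mult_pos_pos) auto
      with v show ?thesis by (simp add: mult.commute)
    qed
    note cacc = caccioppoli[OF B(2) S \<psi> K KS \<psi>0]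
    have cK: "continuous_on ?K \<theta>" "continuous_on ?K (curl \<theta>)" "continuous_on ?K u" "continuous_on T (grad ?\<psi>)"
      "continuous_on T (grad ?\<phi>)" for T
      using c\<theta> cA u KS grad_continuous[OF \<psi>] grad_continuous[OF C1_on_bump[of UNIV 0 "2 * R"]]
      by (auto intro: continuous_on_subset)
    have "(LINT x|lborel. (norm (grad ?\<psi> x))\<^sup>2 * (norm (\<theta> x))\<^sup>2)
        \<le> ((2 * M / R)\<^sup>2 * (2 * c / R)\<^sup>2) * (unit_ball_vol 3 * (4 * R) ^ 3)"
    proof (rule integral_le_cball)
      show "integrable lborel (\<lambda>x. (norm (grad ?\<psi> x))\<^sup>2 * (norm (\<theta> x))\<^sup>2)"
        by (rule integrable_compact_support[OF K]) (auto intro!: continuous_intros cK simp: g\<psi>0)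
      fix x
      show "(norm (grad ?\<psi> x))\<^sup>2 * (norm (\<theta> x))\<^sup>2 \<le> ((2 * M / R)\<^sup>2 * (2 * c / R)\<^sup>2) * indicator (cball 0 (4 * R)) x"
      proof (cases "x \<in> ?K")
        case True
        have "(norm (grad ?\<psi> x))\<^sup>2 * (norm (\<theta> x))\<^sup>2 \<le> (2 * M / R)\<^sup>2 * (2 * c / R)\<^sup>2"
          using g\<psi>[of x] small[OF True decay(1)] by (intro mult_mono power_mono) auto
        then show ?thesis using True by simp
      qed (use g\<psi>0 in auto)
    qed (use Rpos in auto)
    also have "\<dots> = C1 / R" using Rpos(1)
      by (simp add: C1_def \<Theta>_def power_mult_distrib power_divide power2_eq_square power3_eq_cube)
    finally have E: "(LINT x|lborel. (?\<psi> x)\<^sup>2 * (norm (curl \<theta> x))\<^sup>2) \<le> 4 * B\<^sup>2 * (C1 / R)"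
      by (intro order_trans[OF cacc(2)] mult_left_mono) auto
    have g\<phi>0: "grad ?\<phi> x = 0" if "x \<notin> cball 0 (2 * R) - ball 0 R" for x
    proof (cases "x \<in> ball 0 R")
      case True
      then show ?thesis using Rpos by (intro grad_bump_inner) auto
    next
      case False
      then show ?thesis
        using that bump_0[of "2 * R" 0] Rpos by (intro grad_zero_outside[OF closed_cball[of 0 "2 * R"]]) auto
    qed
    have g\<phi>K: "grad ?\<phi> x = 0" if "x \<notin> ?K" for x
      using that Rpos by (intro g\<phi>0) auto
    let ?f = "\<lambda>x. cvec (grad ?\<phi> x) \<bullet>\<^sub>c (curl \<theta> x \<times>\<^sub>c u x)"
    let ?H = "\<lambda>x. (norm (grad ?\<phi> x))\<^sup>2 * (norm (u x))\<^sup>2"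
    let ?E = "\<lambda>x. (?\<psi> x)\<^sup>2 * (norm (curl \<theta> x))\<^sup>2"
    have f: "integrable lborel ?f"
      by (rule integrable_compact_support[OF K])
       (auto intro!: cK bounded_bilinear.continuous_on[OF bounded_bilinear_cdot]
        bounded_bilinear.continuous_on[OF bounded_bilinear_ccross]
        bounded_linear.continuous_on[OF bounded_linear_cvec] simp: g\<phi>K)
    have H: "integrable lborel ?H"
      by (rule integrable_compact_support[OF K]) (auto intro!: continuous_intros cK simp: g\<phi>K)
    have "(LINT x|lborel. ?H x) \<le> ((M / (2 * R))\<^sup>2 * (2 * c / R)\<^sup>2) * (unit_ball_vol 3 * (2 * R) ^ 3)"
    proof (rule integral_le_cball[OF H])
      fix x
      show "?H x \<le> ((M / (2 * R))\<^sup>2 * (2 * c / R)\<^sup>2) * indicator (cball 0 (2 * R)) x"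
      proof (cases "x \<in> cball 0 (2 * R) - ball 0 R")
        case True
        then have xK: "x \<in> ?K" using Rpos by auto
        have "?H x \<le> (M / (2 * R))\<^sup>2 * (2 * c / R)\<^sup>2"
          using M(2)[of "2 * R" 0 x] small[OF xK decay(2)] Rpos by (intro mult_mono power_mono) auto
        then show ?thesis using True by simp
      qed (use g\<phi>0 in auto)
    qed (use Rpos in auto)
    also have "\<dots> = C2 / B\<^sup>2 * 4 / R" using Rpos(1) B(1)
      by (simp add: C2_def \<Theta>_def power_mult_distrib power_divide power2_eq_square power3_eq_cube)
    finally have HI: "(LINT x|lborel. ?H x) \<le> C2 / B\<^sup>2 * 4 / R" .
    have "norm (LINT x|lborel. ?f x) \<le> (LINT x|lborel. 1/2 * ?E x + 1/2 * B\<^sup>2 * ?H x)"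
    proof (rule Bochner_Integration.integral_norm_bound_integral[OF f])
      show "integrable lborel (\<lambda>x. 1/2 * ?E x + 1/2 * B\<^sup>2 * ?H x)" using cacc(1) H by auto
      fix x
      show "norm (?f x) \<le> 1/2 * ?E x + 1/2 * B\<^sup>2 * ?H x"
      proof (cases "x \<in> cball 0 (2 * R) - ball 0 R")
        case True
        then have "?\<psi> x = 1" using Rpos bump_1[of "4 * R" 0 x] bump_0[of R 0 x] by auto
        moreover have "norm (?f x) \<le> norm (curl \<theta> x) * (B * norm (grad ?\<phi> x) * norm (u x))"
          using B(2)[of "grad ?\<phi> x" "curl \<theta> x" "u x"] by (simp add: mult_ac)
        moreover have "\<dots> \<le> 1/2 * (norm (curl \<theta> x))\<^sup>2 + 1/2 * (B * norm (grad ?\<phi> x) * norm (u x))\<^sup>2"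
          using zero_le_power2[of "norm (curl \<theta> x) - B * norm (grad ?\<phi> x) * norm (u x)"]
          unfolding power2_diff by (simp add: power2_eq_square)
        ultimately show ?thesis by (simp add: power_mult_distrib mult_ac)
      qed (simp add: g\<phi>0)
    qed
    also have "\<dots> = 1/2 * (LINT x|lborel. ?E x) + 1/2 * B\<^sup>2 * (LINT x|lborel. ?H x)"
      using cacc(1) H by simp
    also have "\<dots> \<le> 1/2 * (4 * B\<^sup>2 * (C1 / R)) + 1/2 * B\<^sup>2 * (C2 / B\<^sup>2 * 4 / R)"
      using E HI by (intro add_mono mult_left_mono) auto
    also have "\<dots> = (2 * B\<^sup>2 * C1 + 2 * C2) / R" using B(1) by (simp add: add_divide_distrib)
    finally show ?thesis using f by simp
  qed
  then show ?thesis by blast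
qed

section \<open>Traces at the boundary\<close>

text \<open>Extension by limits: each value of \<open>f\<close> in \<open>U\<close> is approximated
  by values on \<open>S\<close>, so control on \<open>S\<close> near \<open>x\<close> passes to all
  of \<open>U\<close> near \<open>x\<close>. It serves for the normal component, whose values on the
  surface are traces while its limits are known only from off the surface.\<close>

lemma continuous_on_from_dense:
  fixes f :: "'a::metric_space \<Rightarrow> 'b::metric_space"
  assumes U: "open U" "U \<subseteq> closure S" and lim: "\<And>x. x \<in> U \<Longrightarrow> (f \<longlongrightarrow> f x) (at x within S)"
  shows "continuous_on U f"
proof (rule continuous_at_imp_continuous_on, rule ballI)
  fix x assume x: "x \<in> U"
  show "isCont f x"
    unfolding continuous_at_eps_delta
  proof (intro allI impI)
    fix e :: real assume "e > 0"
    then obtain d where d: "d > 0" "\<And>z. z \<in> S \<Longrightarrow> z \<noteq> x \<Longrightarrow> dist z x < d \<Longrightarrow> dist (f z) (f x) < e / 2"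
      using lim[OF x] unfolding Lim_within by (metis half_gt_zero zero_less_dist_iff)
    obtain d' where d': "d' > 0" "ball x d' \<subseteq> U" using U(1) x openE by blast
    have "dist (f y) (f x) < e" if y: "dist y x < min d d'" for y
    proof -
      have yU: "y \<in> U" using y d' by (auto simp: dist_commute)
      obtain d2 where d2: "d2 > 0" "\<And>z. z \<in> S \<Longrightarrow> z \<noteq> y \<Longrightarrow> dist z y < d2 \<Longrightarrow> dist (f z) (f y) < e / 2"
        using lim[OF yU] \<open>e > 0\<close> unfolding Lim_within by (metis half_gt_zero zero_less_dist_iff)
      have "min d2 (d - dist y x) > 0" using d2 y by auto
      then obtain z where z: "z \<in> S" "dist z y < min d2 (d - dist y x)"
        using U(2) yU unfolding closure_approachable subset_iff by blast
      have zx: "dist z x < d" using z(2) dist_triangle[of z x y] by auto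
      have "dist (f z) (f y) < e / 2" using d2(2)[OF z(1)] z(2) \<open>e > 0\<close> by (cases "z = y") auto
      moreover have "dist (f z) (f x) < e / 2" using d(2)[OF z(1)] zx \<open>e > 0\<close> by (cases "z = x") auto
      ultimately show ?thesis using dist_triangle3[of "f y" "f x" "f z"] by linarith
    qed
    then show "\<exists>d>0. \<forall>x'. dist x' x < d \<longrightarrow> dist (f x') (f x) < e"
      using d(1) d'(1) by (intro exI[of _ "min d d'"]) auto
  qed
qed

lemma tendsto_bounded_near:
  fixes f :: "'a::metric_space \<Rightarrow> 'b::real_normed_vector"
  assumes "(f \<longlongrightarrow> l) (at x within S)"
  shows "\<exists>d>0. \<exists>C. \<forall>y\<in>S. dist x y < d \<longrightarrow> y \<noteq> x \<longrightarrow> norm (f y) \<le> C"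
proof -
  from assms obtain d where d: "d > 0" "\<And>y. y \<in> S \<Longrightarrow> y \<noteq> x \<Longrightarrow> dist y x < d \<Longrightarrow> dist (f y) l < 1"
    unfolding Lim_within by (metis zero_less_dist_iff zero_less_one)
  have "norm (f y) \<le> norm l + 1" if "y \<in> S" "y \<noteq> x" "dist x y < d" for y
    using d(2)[OF that(1,2)] that(3) norm_triangle_sub[of "f y" l] by (simp add: dist_norm dist_commute)
  with d(1) show ?thesis by blast
qed

text \<open>A limit at each point of the compact closure bounds \<open>f\<close> nearby, and
  finitely many neighbourhoods suffice. It makes fields known through continuity and traces
  integrable over B.\<close>

lemma bounded_image_of_traces:
  fixes f :: "'a::heine_borel \<Rightarrow> 'b::real_normed_vector"
  assumes "bounded S" "\<And>x. x \<in> closure S \<Longrightarrow> \<exists>l. (f \<longlongrightarrow> l) (at x within S)"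
  shows "bounded (f ` S)"
proof -
  have "\<exists>d C. d > 0 \<and> (\<forall>y\<in>S. dist x y < d \<longrightarrow> norm (f y) \<le> C)" if x: "x \<in> closure S" for x
  proof -
    obtain l where "(f \<longlongrightarrow> l) (at x within S)" using assms(2)[OF x] by auto
    from tendsto_bounded_near[OF this] obtain d C
      where "d > 0" "\<And>y. y \<in> S \<Longrightarrow> dist x y < d \<Longrightarrow> y \<noteq> x \<Longrightarrow> norm (f y) \<le> C" by blast
    \<comment> \<open>The limit does not see the point \<open>x\<close> itself, so its value is
      added to the bound.\<close>
    then show ?thesis by (intro exI[of _ d] exI[of _ "max C (norm (f x))"]) (auto simp: le_max_iff_disj)
  qed
  then obtain d C where dC: "\<And>x. x \<in> closure S \<Longrightarrow> d x > 0"
    "\<And>x y. x \<in> closure S \<Longrightarrow> y \<in> S \<Longrightarrow> dist x y < d x \<Longrightarrow> norm (f y) \<le> C x" by metis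
  have "compact (closure S)" using assms(1) by (simp add: compact_closure)
  moreover have "closure S \<subseteq> (\<Union>x\<in>closure S. ball x (d x))" using dC(1) by force
  ultimately obtain I where I: "I \<subseteq> closure S" "finite I" "closure S \<subseteq> (\<Union>x\<in>I. ball x (d x))"
    using compactE_image[of "closure S" "closure S" "\<lambda>x. ball x (d x)"] by auto
  have "norm (f y) \<le> (\<Sum>x\<in>I. \<bar>C x\<bar>)" if "y \<in> S" for y
  proof -
    have "y \<in> closure S" using that closure_subset by auto
    then obtain x where x: "x \<in> I" "dist x y < d x" using I(3) by auto
    then have "norm (f y) \<le> \<bar>C x\<bar>" using dC(2)[of x y] I(1) that by fastforce
    also have "\<dots> \<le> (\<Sum>x\<in>I. \<bar>C x\<bar>)" using x(1) I(2) by (intro member_le_sum) auto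
    finally show ?thesis .
  qed
  then show ?thesis by (auto simp: bounded_iff)
qed

lemma set_integrable_continuous_bounded:
  fixes f :: "'a::euclidean_space \<Rightarrow> 'b::{banach, second_countable_topology}"
  assumes "open S" "bounded S" "continuous_on S f" "bounded (f ` S)"
  shows "set_integrable lborel S f"
proof -
  obtain C where C: "\<And>x. x \<in> S \<Longrightarrow> norm (f x) \<le> C" using assms(4) by (auto simp: bounded_iff)
  have "(\<lambda>x. indicator S x *\<^sub>R f x) \<in> borel_measurable borel"
    using assms(1,3) by (intro borel_measurable_continuous_on_indicator) auto
  then show ?thesis
    unfolding set_integrable_def
    using assms(1) C emeasure_bounded_finite[OF assms(2)]
    by (intro integrableI_bounded_set[where A=S and B=C]) (auto simp: indicator_def)
qed

lemma C1_partial_gderiv: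
  assumes "\<And>y. y \<in> U \<Longrightarrow> GDERIV g y :> G y" "continuous_on U G"
  shows "C1_on U g" "y \<in> U \<Longrightarrow> grad g y = G y"
proof -
  have p: "partial i g y = G y $ i" if "y \<in> U" for i y
    using partial_eq[OF assms(1)[OF that, unfolded gderiv_def], of i] by (simp add: inner_axis' )
  show "y \<in> U \<Longrightarrow> grad g y = G y" by (simp add: grad_def p vec_eq_iff)
  have "continuous_on U (\<lambda>y. G y $ i)" for i using assms(2) by (intro continuous_intros)
  then show "C1_on U g"
    using assms(1) p by (auto simp: C1_on_def gderiv_def differentiable_def cong: continuous_on_cong)
qed

text \<open>\<open>g\<close> vanishes at \<open>x\<close> and has derivative
  \<open>v \<bullet> G x\<close> along the ray, whose sign therefore decides on which side of the
  boundary the ray starts. The conclusion no longer mentions \<open>g\<close>, so different boundary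
  functions can be compared.\<close>

lemma boundary_function_ray:
  assumes b: "boundary_function B x U g G" and x: "x \<in> frontier B"
  shows "v \<bullet> G x < 0 \<Longrightarrow> \<exists>d>0. \<forall>t. 0 < t \<longrightarrow> t < d \<longrightarrow> x + t *\<^sub>R v \<in> B"
    and "v \<bullet> G x > 0 \<Longrightarrow> \<exists>d>0. \<forall>t. 0 < t \<longrightarrow> t < d \<longrightarrow> x + t *\<^sub>R v \<in> - closure B"
proof -
  have U: "open U" "x \<in> U" "GDERIV g x :> G x" "B \<inter> U = {y \<in> U. g y < 0}" "frontier B \<inter> U = {y \<in> U. g y = 0}"
    using b by (auto simp: boundary_function_def)
  have gx: "g x = 0" using U x by auto
  have "((\<lambda>t. x + t *\<^sub>R v) has_derivative (\<lambda>h. h *\<^sub>R v)) (at 0)" by (auto intro!: derivative_eq_intros)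
  from has_derivative_compose[OF this, of g "\<lambda>h. h \<bullet> G x"] U(3)
  have D: "((\<lambda>t. g (x + t *\<^sub>R v)) has_real_derivative v \<bullet> G x) (at 0)"
    by (simp add: gderiv_def has_field_derivative_def mult.commute[of _ "v \<bullet> G x"] mult_commute_abs)
  obtain e where e: "e > 0" "ball x e \<subseteq> U" using U openE by blast
  have dist: "dist x (x + t *\<^sub>R v) < e" if "0 < t" "t < e / (norm v + 1)" for t
  proof -
    have "t * norm v \<le> t * (norm v + 1)" using that by simp
    also have "\<dots> < e" using that by (simp add: pos_less_divide_eq add_nonneg_pos)
    finally show ?thesis using that by (simp add: dist_norm)
  qed
  have pos: "e / (norm v + 1) > 0" using e by (simp add: add_nonneg_pos)
  {
    assume "v \<bullet> G x < 0"
    from has_real_derivative_neg_dec_right[OF D this]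
    obtain d where d: "d > 0" "\<And>h. h > 0 \<Longrightarrow> h < d \<Longrightarrow> g (x + h *\<^sub>R v) < 0" using gx by auto
    have "x + t *\<^sub>R v \<in> B" if "0 < t" "t < min d (e / (norm v + 1))" for t
      using d(2)[of t] dist[of t] that e U(4) by auto
    then show "\<exists>d>0. \<forall>t. 0 < t \<longrightarrow> t < d \<longrightarrow> x + t *\<^sub>R v \<in> B"
      using d pos by (intro exI[of _ "min d (e / (norm v + 1))"]) auto
  }
  {
    assume "v \<bullet> G x > 0"
    from has_real_derivative_pos_inc_right[OF D this]
    obtain d where d: "d > 0" "\<And>h. h > 0 \<Longrightarrow> h < d \<Longrightarrow> g (x + h *\<^sub>R v) > 0" using gx by auto
    have "x + t *\<^sub>R v \<in> - closure B" if t: "0 < t" "t < min d (e / (norm v + 1))" for t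
    proof -
      have "x + t *\<^sub>R v \<in> U" "g (x + t *\<^sub>R v) > 0" using d(2)[of t] dist[of t] t e by auto
      then have "x + t *\<^sub>R v \<notin> B" "x + t *\<^sub>R v \<notin> frontier B" using U(4,5) by force+
      then show ?thesis by (auto simp: frontier_def dest: interior_subset[THEN subsetD])
    qed
    then show "\<exists>d>0. \<forall>t. 0 < t \<longrightarrow> t < d \<longrightarrow> x + t *\<^sub>R v \<in> - closure B"
      using d pos by (intro exI[of _ "min d (e / (norm v + 1))"]) auto
  }
qed

lemma boundary_function_nonzero: "boundary_function B x U g G \<Longrightarrow> G x \<noteq> 0"
  by (auto simp: boundary_function_def)

text \<open>If n and m were different unit normals at \<open>x\<close>, the direction n - m would
  point inward according to m and outward according to n, as n \<bullet> m < 1. A short ray would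
  then lie both in B and outside its closure.\<close>

lemma unit_normal_eq:
  assumes b: "boundary_function B x U g G" and x: "x \<in> frontier B"
  shows "unit_normal B x = G x /\<^sub>R norm (G x)"
  unfolding unit_normal_def
proof (rule the_equality)
  show "\<exists>U g G'. boundary_function B x U g G' \<and> G x /\<^sub>R norm (G x) = G' x /\<^sub>R norm (G' x)" using b by blast
  fix n assume "\<exists>U g G. boundary_function B x U g G \<and> n = G x /\<^sub>R norm (G x)"
  then obtain U' g' G' where b': "boundary_function B x U' g' G'" and n: "n = G' x /\<^sub>R norm (G' x)" by blast
  define m where "m = G x /\<^sub>R norm (G x)"
  have pos: "norm (G x) > 0" "norm (G' x) > 0"
    using boundary_function_nonzero[OF b] boundary_function_nonzero[OF b'] by auto
  have unit: "norm n = 1" "norm m = 1" using pos by (auto simp: n m_def)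
  show "n = G x /\<^sub>R norm (G x)"
  proof (rule ccontr)
    assume "n \<noteq> G x /\<^sub>R norm (G x)"
    then have "n - m \<noteq> 0" by (simp add: m_def)
    then have "(n - m) \<bullet> (n - m) > 0" by simp
    moreover have nn: "n \<bullet> n = 1" "m \<bullet> m = 1" using unit by (simp_all add: dot_square_norm)
    then have "(n - m) \<bullet> (n - m) = 2 - 2 * (n \<bullet> m)"
      by (simp add: inner_diff_left inner_diff_right inner_commute)
    ultimately have lt: "n \<bullet> m < 1" by linarith
    have G: "G x = norm (G x) *\<^sub>R m" "G' x = norm (G' x) *\<^sub>R n" using pos by (auto simp: n m_def)
    have "(n - m) \<bullet> G x = norm (G x) * (n \<bullet> m - 1)"
      by (subst G(1)) (simp add: inner_diff_left nn)
    also have "\<dots> < 0" using pos lt by (simp add: mult_less_0_iff)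
    finally obtain d where d: "d > 0" "\<And>t. 0 < t \<Longrightarrow> t < d \<Longrightarrow> x + t *\<^sub>R (n - m) \<in> B"
      using boundary_function_ray(1)[OF b x] by blast
    have "(n - m) \<bullet> G' x = norm (G' x) * (1 - n \<bullet> m)"
      by (subst G(2)) (simp only: inner_scaleR_right inner_diff_left nn inner_commute[of m n])
    also have "\<dots> > 0" using pos lt by simp
    finally obtain d' where d': "d' > 0" "\<And>t. 0 < t \<Longrightarrow> t < d' \<Longrightarrow> x + t *\<^sub>R (n - m) \<in> - closure B"
      using boundary_function_ray(2)[OF b' x] by blast
    define t where "t = min d d' / 2"
    have "0 < t" "t < d" "t < d'" using d d' by (auto simp: t_def)
    with d(2)[of t] d'(2)[of t] closure_subset[of B] show False by auto
  qed
qed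

text \<open>Rays along -G and G reach \<open>x\<close> from the two sides. On a trivial filter
  limits are not unique, and the \<open>Lim\<close> behind the traces would be meaningless.\<close>

lemma frontier_nontrivial:
  assumes B: "bounded_object B" and x: "x \<in> frontier B"
  shows "at x within B \<noteq> bot" "at x within - closure B \<noteq> bot"
proof -
  obtain U g G where b: "boundary_function B x U g G" using B x by (auto simp: bounded_object_def)
  have nz: "G x \<noteq> 0" by (rule boundary_function_nonzero[OF b])
  have *: "at x within S \<noteq> bot" if ray: "\<exists>d>0. \<forall>t. 0 < t \<longrightarrow> t < d \<longrightarrow> x + t *\<^sub>R v \<in> S" and v0: "v \<noteq> 0" for S v
  proof -
    obtain d where d: "d > 0" "\<And>t. 0 < t \<Longrightarrow> t < d \<Longrightarrow> x + t *\<^sub>R v \<in> S" using ray by blast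
    have "x islimpt S"
      unfolding islimpt_approachable
    proof (intro allI impI)
      fix e :: real assume "e > 0"
      define q t where "q = e / norm v" and "t = min d q / 2"
      have v: "norm v > 0" using v0 by simp
      then have "q > 0" using \<open>e > 0\<close> by (simp add: q_def)
      then have t: "0 < t" "t < d" "t < q" using d(1) by (auto simp: t_def)
      then have "t * norm v < e" using v by (simp add: q_def pos_less_divide_eq)
      then show "\<exists>x'\<in>S. x' \<noteq> x \<and> dist x' x < e"
        using t v0 by (intro bexI[OF _ d(2)[OF t(1,2)]]) (auto simp: dist_norm)
    qed
    then show ?thesis by (simp add: trivial_limit_within)
  qed
  show "at x within B \<noteq> bot" using *[OF boundary_function_ray(1)[OF b x], of "- G x"] nz by simp
  show "at x within - closure B \<noteq> bot" using *[OF boundary_function_ray(2)[OF b x], of "G x"] nz by simp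
qed

lemma has_traces_tendsto:
  assumes "bounded_object B" "has_traces B F" "x \<in> frontier B"
  shows "(F \<longlongrightarrow> trace_in B F x) (at x within B)" "(F \<longlongrightarrow> trace_out B F x) (at x within - closure B)"
  using assms(2,3) frontier_nontrivial[OF assms(1,3)] tendsto_Lim
  unfolding has_traces_def trace_in_def trace_out_def by metis+

lemma frontier_complement: "open B \<Longrightarrow> - frontier B = B \<union> - closure B"
  using closure_subset[of B] by (auto simp: frontier_def interior_open)

text \<open>The patch is a ball in which one slope of \<open>g\<close> persists and \<open>F\<close>
  and \<open>D\<close> are bounded because they have traces. Traces do not control values on the
  surface itself, hence the normalisation to 0 there.\<close>

lemma weak_identity_boundary:
  assumes B: "bounded_object B" and x0: "x0 \<in> frontier B"
    and F: "C1_on (- frontier B) F" "\<And>y. y \<notin> frontier B \<Longrightarrow> divergence F y = D y"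
    and zero: "\<And>y. y \<in> frontier B \<Longrightarrow> F y = 0" "\<And>y. y \<in> frontier B \<Longrightarrow> D y = 0"
    and traces: "has_traces B F" "has_traces B D"
    and normal: "\<And>y. y \<in> frontier B \<Longrightarrow>
      cvec (unit_normal B y) \<bullet>\<^sub>c trace_in B F y = cvec (unit_normal B y) \<bullet>\<^sub>c trace_out B F y"
  shows "\<exists>r>0. \<forall>\<phi>. C1_on UNIV \<phi> \<longrightarrow> (\<forall>y. y \<notin> cball x0 r \<longrightarrow> \<phi> y = 0) \<longrightarrow> weak_identity F D \<phi>"
proof -
  have oB: "open B" using B by (simp add: bounded_object_def)
  obtain U g G where b: "boundary_function B x0 U g G" using B x0 by (auto simp: bounded_object_def)
  then have U: "open U" "x0 \<in> U" "\<And>y. y \<in> U \<Longrightarrow> GDERIV g y :> G y" "continuous_on U G" "\<And>y. y \<in> U \<Longrightarrow> G y \<noteq> 0"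
    "B \<inter> U = {y \<in> U. g y < 0}" "frontier B \<inter> U = {y \<in> U. g y = 0}"
    by (auto simp: boundary_function_def)
  have bf: "boundary_function B y U g G" if "y \<in> U" for y using b that by (auto simp: boundary_function_def)
  have fr: "y \<in> frontier B \<longleftrightarrow> g y = 0" if "y \<in> U" for y using U(7) that by auto
  have "G x0 \<noteq> 0" using U by auto
  then obtain i where i: "G x0 $ i \<noteq> 0" by (auto simp: vec_eq_iff)
  \<comment> \<open>\<open>c\<close> is half the slope at \<open>x0\<close>, so that continuity of
    \<open>G\<close> preserves it as a lower bound nearby.\<close>
  define s c where "s = sgn (G x0 $ i)" and "c = \<bar>G x0 $ i\<bar> / 2"
  have s: "\<bar>s\<bar> = 1" "c > 0" using i by (auto simp: s_def c_def abs_sgn_eq)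
  have "isCont (\<lambda>y. s * G y $ i) x0"
    using U by (intro continuous_intros) (auto simp: continuous_on_eq_continuous_at)
  then obtain d1 where d1: "d1 > 0" "\<And>y. dist y x0 < d1 \<Longrightarrow> dist (s * G y $ i) (s * G x0 $ i) < c"
    unfolding continuous_at_eps_delta using s(2) by blast
  have "s * G x0 $ i = 2 * c" by (auto simp: s_def c_def sgn_if)
  then have d1c: "s * G y $ i > c" if "dist y x0 < d1" for y
    using d1(2)[OF that] by (auto simp: dist_real_def)
  have bd: "\<exists>d>0. \<exists>C. \<forall>y. dist x0 y < d \<longrightarrow> norm (f y) \<le> C"
    if t: "has_traces B f" and z: "\<And>y. y \<in> frontier B \<Longrightarrow> f y = 0" for f :: "real^3 \<Rightarrow> 'z::real_normed_vector"
  proof -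
    obtain d C d' C' where 1: "d > 0" "d' > 0"
      "\<And>y. y \<in> B \<Longrightarrow> dist x0 y < d \<Longrightarrow> y \<noteq> x0 \<Longrightarrow> norm (f y) \<le> C"
      "\<And>y. y \<in> - closure B \<Longrightarrow> dist x0 y < d' \<Longrightarrow> y \<noteq> x0 \<Longrightarrow> norm (f y) \<le> C'"
      using tendsto_bounded_near[OF has_traces_tendsto(1)[OF B t x0]]
        tendsto_bounded_near[OF has_traces_tendsto(2)[OF B t x0]] by blast
    have "norm (f y) \<le> max 0 (max C C')" if "dist x0 y < min d d'" for y
      using 1(3)[of y] 1(4)[of y] that z[of y] x0 frontier_complement[OF oB]
      by (cases "y \<in> frontier B") (auto simp: le_max_iff_disj)
    then show ?thesis using 1 by (intro exI[of _ "min d d'"]) auto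
  qed
  obtain d2 C2 where d2: "d2 > 0" "\<And>y. dist x0 y < d2 \<Longrightarrow> norm (F y) \<le> C2" using bd[OF traces(1) zero(1)] by blast
  obtain d3 C3 where d3: "d3 > 0" "\<And>y. dist x0 y < d3 \<Longrightarrow> norm (D y) \<le> C3" using bd[OF traces(2) zero(2)] by blast
  obtain d4 where d4: "d4 > 0" "ball x0 d4 \<subseteq> U" using U openE by blast
  define d where "d = min (min d1 d2) (min d3 d4)"
  have d: "d > 0" "d \<le> d1" "d \<le> d2" "d \<le> d3" "d \<le> d4" using d1 d2 d3 d4 by (auto simp: d_def)
  define V where "V = ball x0 d"
  have VU: "V \<subseteq> U" using d4 d by (auto simp: V_def)
  have oV: "open V" by (simp add: V_def)
  have C1g: "C1_on V g" and gradg: "y \<in> V \<Longrightarrow> grad g y = G y" for y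
    using C1_partial_gderiv[of V g G] U(3,4) VU continuous_on_subset by blast+
  \<comment> \<open>A quarter, so that the closed ball of radius \<open>2 * r\<close> lies in the
    open ball \<open>V\<close>.\<close>
  define r where "r = d / 4"
  interpret boundary_patch V g x0 r s c i
  proof
    show "cball x0 (2 * r) \<subseteq> V" using d by (auto simp: V_def r_def)
    fix y assume "y \<in> cball x0 (2 * r)"
    then have y: "y \<in> V" "dist y x0 < d1" using d by (auto simp: V_def r_def dist_commute)
    show "c \<le> s * partial i g y" using d1c[OF y(2)] gradg[OF y(1)] by (auto simp: grad_def vec_eq_iff)
  qed (use d s oV C1g in \<open>auto simp: r_def\<close>)
  \<comment> \<open>The normal component scaled by the norm of \<open>G\<close>. On the surface the
    inner trace is taken; by \<open>normal\<close> the outer one gives the same value.\<close>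
  define N where "N y = cvec (G y) \<bullet>\<^sub>c (if y \<in> frontier B then trace_in B F y else F y)" for y
  let ?S = "V \<inter> - frontier B"
  have "continuous_on V N"
  proof (rule continuous_on_from_dense[OF oV])
    show "V \<subseteq> closure ?S"
    proof
      fix x assume x: "x \<in> V"
      show "x \<in> closure ?S"
      proof (cases "x \<in> frontier B")
        case True
        then have "x \<in> V \<inter> closure B" using x by (auto simp: frontier_def)
        then have "x \<in> closure (V \<inter> B)" using open_Int_closure_subset[OF oV] by auto
        moreover have "V \<inter> B \<subseteq> ?S" using frontier_complement[OF oB] by auto
        ultimately show ?thesis using closure_mono by blast
      next
        case False
        then show ?thesis using x closure_subset[of ?S] by auto
      qed
    qed
    fix x assume x: "x \<in> V"
    have Gx: "(G \<longlongrightarrow> G x) (at x within T)" for T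
      using U(1,4) x VU by (auto simp: continuous_on_eq_continuous_at continuous_at intro: tendsto_within_subset)
    have NF: "\<forall>\<^sub>F y in at x within T. cvec (G y) \<bullet>\<^sub>c F y = N y" if "T \<subseteq> - frontier B" for T
      unfolding eventually_at_filter by (rule always_eventually) (use that in \<open>auto simp: N_def\<close>)
    have lim: "(N \<longlongrightarrow> cvec (G x) \<bullet>\<^sub>c l) (at x within T)"
      if "(F \<longlongrightarrow> l) (at x within T)" "T \<subseteq> - frontier B" for T l
      by (rule Lim_transform_eventually[OF _ NF[OF that(2)]])
        (intro bounded_bilinear.tendsto[OF bounded_bilinear_cdot] bounded_linear.tendsto[OF bounded_linear_cvec] Gx that(1))
    show "(N \<longlongrightarrow> N x) (at x within ?S)"
    proof (cases "x \<in> frontier B")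
      case False
      then have "isCont F x" using C1_on_continuous[OF F(1)]
        by (simp add: continuous_on_eq_continuous_at open_Compl)
      then have "(F \<longlongrightarrow> F x) (at x within ?S)" by (auto simp: continuous_at intro: tendsto_within_subset)
      from lim[OF this] show ?thesis using False by (simp add: N_def)
    next
      case True
      have n: "unit_normal B x = G x /\<^sub>R norm (G x)" by (rule unit_normal_eq[OF bf True]) (use x VU in auto)
      have "norm (G x) > 0" using U(5) x VU by auto
      then have "G x = norm (G x) *\<^sub>R unit_normal B x" by (simp add: n)
      then have "cvec (G x) = norm (G x) *\<^sub>R cvec (unit_normal B x)" by (metis cvec_simps(3))
      then have io: "cvec (G x) \<bullet>\<^sub>c trace_in B F x = cvec (G x) \<bullet>\<^sub>c trace_out B F x"
        using normal[OF True] by (simp add: bounded_bilinear.scaleR_left[OF bounded_bilinear_cdot])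
      have "(N \<longlongrightarrow> cvec (G x) \<bullet>\<^sub>c trace_in B F x) (at x within B)"
        "(N \<longlongrightarrow> cvec (G x) \<bullet>\<^sub>c trace_out B F x) (at x within - closure B)"
        using frontier_complement[OF oB]
        by (intro lim has_traces_tendsto[OF B traces(1) True]; auto)+
      then have "(N \<longlongrightarrow> N x) (at x within (B \<union> - closure B))"
        using True io by (intro Lim_Un) (simp_all add: N_def)
      then show ?thesis by (rule tendsto_within_subset) (use frontier_complement[OF oB] in auto)
    qed
  qed
  note wd = weak_divergence[of F D "max C2 C3" N]
  have yf: "y \<in> frontier B \<longleftrightarrow> g y = 0" if "y \<in> V" for y using that fr VU by blast
  have bounds: "norm (F y) \<le> max C2 C3" "norm (D y) \<le> max C2 C3" if "y \<in> V" for y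
    using d2(2)[of y] d3(2)[of y] that d by (auto simp: V_def)
  have surface: "F y = 0" "D y = 0" if "y \<in> V" "g y = 0" for y using that yf zero by auto
  have off: "divergence F y = D y" "N y = cvec (grad g y) \<bullet>\<^sub>c F y" if "y \<in> V" "g y \<noteq> 0" for y
    using that yf F(2) gradg by (auto simp: N_def)
  have C1_F: "C1_on {y \<in> V. g y \<noteq> 0} F" using fr VU by (intro C1_on_subset[OF F(1)]) auto
  have "weak_identity F D \<phi>" if \<phi>: "C1_on UNIV \<phi>" "\<And>y. y \<notin> cball x0 r \<Longrightarrow> \<phi> y = 0" for \<phi>
    unfolding weak_identity_def
    by (intro conjI; rule wd; fact C1_F off surface bounds \<open>continuous_on V N\<close> \<phi>)
  moreover have "r > 0" using d by (simp add: r_def)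
  ultimately show ?thesis by blast
qed

section \<open>Reciprocity\<close>

lemma ccross_triple: "n \<bullet>\<^sub>c (a \<times>\<^sub>c b) = (n \<times>\<^sub>c a) \<bullet>\<^sub>c b" "n \<bullet>\<^sub>c (a \<times>\<^sub>c b) = - ((n \<times>\<^sub>c b) \<bullet>\<^sub>c a)"
  by (simp_all add: cdot_3 ccross_nth algebra_simps)

lemma cdot_commute: "a \<bullet>\<^sub>c b = b \<bullet>\<^sub>c a"
  by (simp add: cdot_def mult.commute)

text \<open>In the triple product either factor can be paired with \<open>n\<close> first, so the
  two are exchanged one after the other.\<close>

lemma normal_cross_eq:
  assumes "n \<times>\<^sub>c a = n \<times>\<^sub>c a'" "n \<times>\<^sub>c b = n \<times>\<^sub>c b'"
  shows "n \<bullet>\<^sub>c (a \<times>\<^sub>c b) = n \<bullet>\<^sub>c (a' \<times>\<^sub>c b')"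
proof -
  have "n \<bullet>\<^sub>c (a \<times>\<^sub>c b) = n \<bullet>\<^sub>c (a' \<times>\<^sub>c b)" by (simp add: ccross_triple(1) assms(1))
  also have "\<dots> = n \<bullet>\<^sub>c (a' \<times>\<^sub>c b')" by (simp add: ccross_triple(2) assms(2))
  finally show ?thesis .
qed

definition source :: "3 \<Rightarrow> 3 list \<Rightarrow> real^3 \<Rightarrow> complex^3" where
  "source j J \<xi> = of_real (Pi_mon J \<xi>) *s (unit_vec j \<times>\<^sub>c cvec \<xi>)"

lemma bounded_bilinear_smult: "bounded_bilinear ((*s) :: complex \<Rightarrow> complex^3 \<Rightarrow> complex^3)"
  unfolding bilinear_conv_bounded_bilinear[symmetric] bilinear_def
  by (auto intro!: linearI simp: vec_eq_iff algebra_simps)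

lemma Pi_mon_continuous: "continuous_on S (Pi_mon J)"
  unfolding Pi_mon_def[abs_def] by (induction J) (auto intro!: continuous_intros)

lemma source_continuous: "continuous_on S (source j J)"
  unfolding source_def[abs_def]
  by (intro bounded_bilinear.continuous_on[OF bounded_bilinear_smult]
      bounded_bilinear.continuous_on[OF bounded_bilinear_ccross] continuous_intros Pi_mon_continuous
      linear_continuous_on[OF bounded_linear_cvec])

lemma partial_minus: "F differentiable (at x) \<Longrightarrow> partial i (\<lambda>y. - F y) x = - partial i F x"
  by (rule partial_linear[OF bounded_linear_minus[OF bounded_linear_ident]])

lemma divergence_diff:
  assumes "F differentiable (at x)" "H differentiable (at x)"
  shows "divergence (\<lambda>y. F y - H y) x = divergence F x - divergence H x"
proof -
  have "partial i (\<lambda>y. F y - H y) x = partial i F x - partial i H x" for i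
    using partial_add[OF assms(1) differentiable_minus[OF assms(2)], of i] partial_minus[OF assms(2), of i]
    by simp
  then show ?thesis by (simp add: divergence_def sum_subtractf)
qed

lemma trace_eqI:
  assumes "bounded_object B" "x \<in> frontier B"
  shows "(F \<longlongrightarrow> l) (at x within B) \<Longrightarrow> trace_in B F x = l"
    and "(F \<longlongrightarrow> l) (at x within - closure B) \<Longrightarrow> trace_out B F x = l"
  using frontier_nontrivial[OF assms] by (auto simp: trace_in_def trace_out_def tendsto_Lim)

text \<open>The normal is frozen at \<open>x\<close>, as in the boundary conditions, so only the
  field has to converge.\<close>

lemma tangential_jump:
  assumes B: "bounded_object B" and F: "has_traces B F" and x: "x \<in> frontier B"
  shows "jump B (\<lambda>y. n \<times>\<^sub>c F y) x = n \<times>\<^sub>c trace_out B F x - n \<times>\<^sub>c trace_in B F x"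
proof -
  note cross = bounded_bilinear.tendsto[OF bounded_bilinear_ccross tendsto_const[of n]]
  show ?thesis
    unfolding jump_def trace_eqI(1)[OF B x cross[OF has_traces_tendsto(1)[OF B F x]]]
      trace_eqI(2)[OF B x cross[OF has_traces_tendsto(2)[OF B F x]]] ..
qed

text \<open>At permeability one \<open>mu_tilde\<close> is constant, its jump is 0 and the right
  side of the curl condition disappears. Otherwise the tangential curl could jump, and with it the
  normal component of the combined field.\<close>

lemma transmission_solutionD:
  assumes B: "bounded_object B" and t: "transmission_solution B \<nu> 1 j J \<theta>"
  shows "C2_on (- frontier B) \<theta>" "has_traces B \<theta>" "has_traces B (curl \<theta>)"
    and "\<And>\<xi>. \<xi> \<in> B \<Longrightarrow> curl (curl \<theta>) \<xi> = (\<i> * of_real \<nu>) *s (\<theta> \<xi> + source j J \<xi>)"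
    and "\<And>\<xi>. \<xi> \<in> - closure B \<Longrightarrow> curl (curl \<theta>) \<xi> = 0"
    and "\<And>\<xi>. \<xi> \<in> frontier B \<Longrightarrow>
      cvec (unit_normal B \<xi>) \<times>\<^sub>c trace_in B \<theta> \<xi> = cvec (unit_normal B \<xi>) \<times>\<^sub>c trace_out B \<theta> \<xi>"
    and "\<And>\<xi>. \<xi> \<in> frontier B \<Longrightarrow>
      cvec (unit_normal B \<xi>) \<times>\<^sub>c trace_in B (curl \<theta>) \<xi> = cvec (unit_normal B \<xi>) \<times>\<^sub>c trace_out B (curl \<theta>) \<xi>"
    and "\<exists>c R. R > 0 \<and> (\<forall>\<xi>. norm \<xi> \<ge> R \<longrightarrow> norm (\<theta> \<xi>) \<le> c / norm \<xi>)"
proof -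
  have oB: "open B" using B by (simp add: bounded_object_def)
  note T = t[unfolded transmission_solution_def]
  show tr: "has_traces B \<theta>" "has_traces B (curl \<theta>)" using T by auto
  have "C2_on (B \<union> - closure B) \<theta>"
    using T oB by (auto simp: C2_on_def intro!: C1_on_Un)
  then show "C2_on (- frontier B) \<theta>" by (simp add: frontier_complement[OF oB])
  show "curl (curl \<theta>) \<xi> = 0" if "\<xi> \<in> - closure B" for \<xi> using T that by auto
  show "curl (curl \<theta>) \<xi> = (\<i> * of_real \<nu>) *s (\<theta> \<xi> + source j J \<xi>)" if "\<xi> \<in> B" for \<xi>
  proof -
    have "curl (\<lambda>y. of_real (inverse 1) *s curl \<theta> y) \<xi> - (\<i> * of_real \<nu>) *s \<theta> \<xi>
            = (\<i> * of_real \<nu> * of_real (Pi_mon J \<xi>)) *s (unit_vec j \<times>\<^sub>c cvec \<xi>)"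
      using T that by blast
    then show ?thesis by (simp add: source_def vector_add_ldistrib vector_smult_assoc diff_eq_eq add.commute)
  qed
  fix \<xi> assume x: "\<xi> \<in> frontier B"
  have "jump B (\<lambda>y. cvec (unit_normal B \<xi>) \<times>\<^sub>c \<theta> y) \<xi> = 0" using T x by blast
  then show "cvec (unit_normal B \<xi>) \<times>\<^sub>c trace_in B \<theta> \<xi> = cvec (unit_normal B \<xi>) \<times>\<^sub>c trace_out B \<theta> \<xi>"
    by (simp add: tangential_jump[OF B tr(1) x])
  have "jump B (\<lambda>y. inverse (mu_tilde B 1 y)) \<xi> = 0"
    using trace_eqI(1)[OF B x tendsto_const[of "1::real"]] trace_eqI(2)[OF B x tendsto_const[of "1::real"]]
    by (simp add: jump_def mu_tilde_def)
  moreover have "jump B (\<lambda>y. cvec (unit_normal B \<xi>) \<times>\<^sub>c (of_real (inverse (mu_tilde B 1 y)) *s curl \<theta> y)) \<xi>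
        = - ((of_nat (length J + 2) * of_real (jump B (\<lambda>y. inverse (mu_tilde B 1 y)) \<xi>)) *s
             (cvec (unit_normal B \<xi>) \<times>\<^sub>c (of_real (Pi_mon J \<xi>) *s unit_vec j)))"
    using T x by blast
  ultimately have "jump B (\<lambda>y. cvec (unit_normal B \<xi>) \<times>\<^sub>c curl \<theta> y) \<xi> = 0"
    by (simp add: mu_tilde_def)
  then show "cvec (unit_normal B \<xi>) \<times>\<^sub>c trace_in B (curl \<theta>) \<xi> = cvec (unit_normal B \<xi>) \<times>\<^sub>c trace_out B (curl \<theta>) \<xi>"
    by (simp add: tangential_jump[OF B tr(2) x])
next
  have "(\<lambda>\<xi>. norm (\<theta> \<xi>)) \<in> O[at_infinity](\<lambda>\<xi>. inverse (norm \<xi>))"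
    using t by (auto simp: transmission_solution_def)
  then obtain c where "\<forall>\<^sub>F \<xi> in at_infinity. norm (norm (\<theta> \<xi>)) \<le> c * norm (inverse (norm \<xi>))"
    by (rule landau_o.bigE)
  then obtain R where R: "\<And>\<xi>. R \<le> norm \<xi> \<Longrightarrow> norm (\<theta> \<xi>) \<le> c * inverse (norm \<xi>)"
    by (auto simp: eventually_at_infinity)
  show "\<exists>c R. R > 0 \<and> (\<forall>\<xi>. norm \<xi> \<ge> R \<longrightarrow> norm (\<theta> \<xi>) \<le> c / norm \<xi>)"
    using R by (intro exI[of _ c] exI[of _ "max R 1"]) (auto simp: divide_inverse)
qed

lemma has_traces_piecewise:
  assumes "open B" and F: "\<And>x. x \<in> frontier B \<Longrightarrow> (f1 \<longlongrightarrow> l1 x) (at x within B)"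
      "\<And>x. x \<in> frontier B \<Longrightarrow> (f2 \<longlongrightarrow> l2 x) (at x within - closure B)"
    and eq: "\<And>y. y \<in> B \<Longrightarrow> F y = f1 y" "\<And>y. y \<in> - closure B \<Longrightarrow> F y = f2 y"
  shows "has_traces B F"
proof -
  have "(F \<longlongrightarrow> l1 x) (at x within B)" "(F \<longlongrightarrow> l2 x) (at x within - closure B)" if "x \<in> frontier B" for x
    using F[OF that] eq by (auto elim!: Lim_transform_eventually simp: eventually_at_filter)
  then show ?thesis unfolding has_traces_def by blast
qed

text \<open>The analogue of Lorentz reciprocity in electromagnetism. The integrand is a function on
  the whole space, extended by zero, because in this form it is the weak divergence of the combined
  field.\<close>

lemma reciprocity:
  assumes B: "bounded_object B"
    and t1: "transmission_solution B \<nu> 1 k K \<theta>1" and t2: "transmission_solution B \<nu> 1 j J \<theta>2"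
  shows "(LINT y|lborel. (if y \<in> B then (\<i> * of_real \<nu>) * (source k K y \<bullet>\<^sub>c \<theta>2 y - source j J y \<bullet>\<^sub>c \<theta>1 y) else 0)) = 0"
proof -
  note s1 = transmission_solutionD[OF B t1] and s2 = transmission_solutionD[OF B t2]
  have oB: "open B" and bB: "bounded B" using B by (auto simp: bounded_object_def)
  let ?A1 = "curl \<theta>1" and ?A2 = "curl \<theta>2"
  let ?F = "\<lambda>y. ?A1 y \<times>\<^sub>c \<theta>2 y - ?A2 y \<times>\<^sub>c \<theta>1 y"
  \<comment> \<open>On the boundary only the traces of \<open>?F\<close> carry information; its
    values are reset to 0, as the local lemma expects.\<close>
  define F where "F y = (if y \<in> frontier B then 0 else ?F y)" for y
  define f where "f y = (\<i> * of_real \<nu>) * (source k K y \<bullet>\<^sub>c \<theta>2 y - source j J y \<bullet>\<^sub>c \<theta>1 y)" for y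
  define D where "D y = (if y \<in> B then f y else 0)" for y
  have fr: "open (- frontier B)" "- frontier B = B \<union> - closure B"
    by (simp add: open_Compl) (rule frontier_complement[OF oB])
  have disj: "B \<inter> closure B = B" "B \<inter> frontier B = {}" using closure_subset oB by (auto simp: frontier_def interior_open)
  have c1: "C1_on (- frontier B) \<theta>1" "C1_on (- frontier B) ?A1"
    and c2: "C1_on (- frontier B) \<theta>2" "C1_on (- frontier B) ?A2"
    using s1(1) s2(1) C1_on_curl by (auto simp: C2_on_def)
  have CF': "C1_on (- frontier B) ?F" by (intro C1_on_diff C1_on_ccross c1 c2)
  have CF: "C1_on (- frontier B) F" by (rule C1_on_cong_open[OF fr(1) _ CF']) (simp add: F_def)
  have div: "divergence F y = D y" if "y \<notin> frontier B" for y
  proof -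
    have y: "y \<in> - frontier B" using that by simp
    note d = C1_onD(1)[OF c1(1) y] C1_onD(1)[OF c1(2) y] C1_onD(1)[OF c2(1) y] C1_onD(1)[OF c2(2) y]
    have "divergence F y = divergence ?F y"
      by (rule divergence_cong_open[OF fr(1) y]) (simp add: F_def)
    \<comment> \<open>Two cancellations follow: the products of the two curls by symmetry and,
      inside \<open>B\<close>, the products of \<theta>1 and \<theta>2 that both equations
      contribute.\<close>
    also have "\<dots> = (curl ?A1 y \<bullet>\<^sub>c \<theta>2 y - ?A1 y \<bullet>\<^sub>c ?A2 y) - (curl ?A2 y \<bullet>\<^sub>c \<theta>1 y - ?A2 y \<bullet>\<^sub>c ?A1 y)"
      using d by (simp add: divergence_diff differentiable_bilinear[OF bounded_bilinear_ccross] divergence_ccross)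
    also have "\<dots> = curl ?A1 y \<bullet>\<^sub>c \<theta>2 y - curl ?A2 y \<bullet>\<^sub>c \<theta>1 y"
      by (simp add: cdot_commute[of "?A1 y"])
    also have "\<dots> = D y"
    proof (cases "y \<in> B")
      case True
      then show ?thesis by (simp add: s1(4) s2(4) D_def f_def cdot_3 algebra_simps)
    next
      case False
      then have "y \<in> - closure B" using y fr(2) by auto
      then show ?thesis using False by (simp add: s1(5) s2(5) D_def)
    qed
    finally show ?thesis .
  qed
  have limF: "(?F \<longlongrightarrow> a1 \<times>\<^sub>c b2 - a2 \<times>\<^sub>c b1) A"
    if "(?A1 \<longlongrightarrow> a1) A" "(\<theta>1 \<longlongrightarrow> b1) A" "(?A2 \<longlongrightarrow> a2) A" "(\<theta>2 \<longlongrightarrow> b2) A" for a1 b1 a2 b2 A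
    by (intro tendsto_diff bounded_bilinear.tendsto[OF bounded_bilinear_ccross] that)
  note tr1 = has_traces_tendsto[OF B s1(2)] has_traces_tendsto[OF B s1(3)]
  note tr2 = has_traces_tendsto[OF B s2(2)] has_traces_tendsto[OF B s2(3)]
  have limF_in: "(?F \<longlongrightarrow> trace_in B ?A1 x \<times>\<^sub>c trace_in B \<theta>2 x - trace_in B ?A2 x \<times>\<^sub>c trace_in B \<theta>1 x) (at x within B)"
    and limF_out: "(?F \<longlongrightarrow> trace_out B ?A1 x \<times>\<^sub>c trace_out B \<theta>2 x - trace_out B ?A2 x \<times>\<^sub>c trace_out B \<theta>1 x) (at x within - closure B)"
    if "x \<in> frontier B" for x
    using tr1[OF that] tr2[OF that] by (intro limF; simp)+
  have F_ev: "\<forall>\<^sub>F y in at x within T. ?F y = F y" if "T \<subseteq> - frontier B" for x T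
    unfolding eventually_at_filter by (rule always_eventually) (use that in \<open>auto simp: F_def\<close>)
  have F_in: "(F \<longlongrightarrow> trace_in B ?A1 x \<times>\<^sub>c trace_in B \<theta>2 x - trace_in B ?A2 x \<times>\<^sub>c trace_in B \<theta>1 x) (at x within B)"
    and F_out: "(F \<longlongrightarrow> trace_out B ?A1 x \<times>\<^sub>c trace_out B \<theta>2 x - trace_out B ?A2 x \<times>\<^sub>c trace_out B \<theta>1 x) (at x within - closure B)"
    if "x \<in> frontier B" for x
    by (rule Lim_transform_eventually[OF limF_in[OF that] F_ev], use fr in blast,
        rule Lim_transform_eventually[OF limF_out[OF that] F_ev], use fr in blast)
  have trF: "has_traces B F" using F_in F_out unfolding has_traces_def by blast
  have normal: "cvec (unit_normal B x) \<bullet>\<^sub>c trace_in B F x = cvec (unit_normal B x) \<bullet>\<^sub>c trace_out B F x"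
    if x: "x \<in> frontier B" for x
    unfolding trace_eqI(1)[OF B x F_in[OF x]] trace_eqI(2)[OF B x F_out[OF x]]
      bounded_bilinear.diff_right[OF bounded_bilinear_cdot]
    by (intro arg_cong2[of _ _ _ _ minus] normal_cross_eq s1 s2 x)
  have lim_source: "(source i I \<longlongrightarrow> source i I x) (at x within T)" for i I x T
    using source_continuous[of UNIV i I] by (auto simp: continuous_on_eq_continuous_at continuous_at intro: tendsto_within_subset)
  have trD: "has_traces B D"
  proof (rule has_traces_piecewise[OF oB])
    fix x assume x: "x \<in> frontier B"
    show "(f \<longlongrightarrow> (\<i> * of_real \<nu>) * (source k K x \<bullet>\<^sub>c trace_in B \<theta>2 x - source j J x \<bullet>\<^sub>c trace_in B \<theta>1 x)) (at x within B)"
      unfolding f_def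
      by (intro tendsto_intros bounded_bilinear.tendsto[OF bounded_bilinear_cdot] lim_source tr1 tr2 x)
    show "((\<lambda>_. 0 :: complex) \<longlongrightarrow> 0) (at x within - closure B)" by simp
  qed (use disj in \<open>auto simp: D_def\<close>)
  have loc: "\<exists>r>0. \<forall>\<phi>. C1_on UNIV \<phi> \<longrightarrow> (\<forall>y. y \<notin> cball x r \<longrightarrow> \<phi> y = 0) \<longrightarrow> weak_identity F D \<phi>" for x
  proof (cases "x \<in> frontier B")
    case True
    show ?thesis
      by (rule weak_identity_boundary[OF B True CF div _ _ trF trD normal]) (use disj in \<open>auto simp: F_def D_def\<close>)
  next
    case False
    then obtain r where "r > 0" "cball x r \<subseteq> - frontier B" using fr(1) open_contains_cball by blast
    then show ?thesis
      using weak_identity_smooth[OF fr(1) _ CF] div by blast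
  qed
  obtain c1 R1 where R1: "R1 > 0" "\<And>x. norm x \<ge> R1 \<Longrightarrow> norm (\<theta>1 x) \<le> c1 / norm x" using s1(8) by blast
  obtain c2 R2 where R2: "R2 > 0" "\<And>x. norm x \<ge> R2 \<Longrightarrow> norm (\<theta>2 x) \<le> c2 / norm x" using s2(8) by blast
  obtain R3 where R3: "\<And>x. x \<in> closure B \<Longrightarrow> norm x \<le> R3"
    using bounded_closure[OF bB] by (auto simp: bounded_iff)
  \<comment> \<open>The added 1 puts points of norm at least \<open>R0\<close> strictly beyond
    \<open>closure B\<close>.\<close>
  define R0 where "R0 = max (max R1 R2) (R3 + 1)"
  define c where "c = max c1 c2"
  have R0: "x \<in> - closure B" "norm (\<theta>1 x) \<le> c / norm x" "norm (\<theta>2 x) \<le> c / norm x"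
    if x: "norm x \<ge> R0" for x
  proof -
    have n: "norm x > 0" "norm x \<ge> R1" "norm x \<ge> R2" "norm x > R3" using x R1(1) by (auto simp: R0_def)
    show "x \<in> - closure B" using R3[of x] n(4) by auto
    have "c1 / norm x \<le> c / norm x" "c2 / norm x \<le> c / norm x"
      using n(1) by (auto simp: c_def intro!: divide_right_mono)
    then show "norm (\<theta>1 x) \<le> c / norm x" "norm (\<theta>2 x) \<le> c / norm x"
      using R1(2)[OF n(2)] R2(2)[OF n(3)] by linarith+
  qed
  have S: "open (- closure B)" by (simp add: open_Compl)
  have sub: "- closure B \<subseteq> - frontier B" using fr by auto
  have C2: "C2_on (- closure B) \<theta>1" "C2_on (- closure B) \<theta>2"
    using s1(1) s2(1) sub by (auto simp: C2_on_def intro: C1_on_subset)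
  have cont: "continuous_on (- closure B) \<theta>1" "continuous_on (- closure B) \<theta>2"
    using C1_on_continuous[OF c1(1)] C1_on_continuous[OF c2(1)] sub by (auto intro: continuous_on_subset)
  have R0pos: "R0 > 0" using R1 by (simp add: R0_def)
  let ?g = "\<lambda>R y. cvec (grad (bump 0 (2 * R)) y)"
  obtain C1 where C1: "\<And>R. R \<ge> 2 * R0 \<Longrightarrow> integrable lborel (\<lambda>x. ?g R x \<bullet>\<^sub>c (?A1 x \<times>\<^sub>c \<theta>2 x))"
      "\<And>R. R \<ge> 2 * R0 \<Longrightarrow> norm (LINT x|lborel. ?g R x \<bullet>\<^sub>c (?A1 x \<times>\<^sub>c \<theta>2 x)) \<le> C1 / R"
    using far_field[OF S C2(1) s1(5) R0pos R0(1) cont(2) R0(2,3)] by blast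
  obtain C2 where C2: "\<And>R. R \<ge> 2 * R0 \<Longrightarrow> integrable lborel (\<lambda>x. ?g R x \<bullet>\<^sub>c (?A2 x \<times>\<^sub>c \<theta>1 x))"
      "\<And>R. R \<ge> 2 * R0 \<Longrightarrow> norm (LINT x|lborel. ?g R x \<bullet>\<^sub>c (?A2 x \<times>\<^sub>c \<theta>1 x)) \<le> C2 / R"
    using far_field[OF S C2(2) s2(5) R0pos R0(1) cont(1) R0(3,2)] by blast
  have est: "norm (LINT y|lborel. D y) \<le> (C1 + C2) / R" if R: "R \<ge> 2 * R0" for R
  proof -
    let ?\<phi> = "bump (0::real^3) (2 * R)"
    have Rpos: "R > 0" using R R0pos by linarith
    have "weak_identity F D ?\<phi>"
      by (rule weak_identity_global[OF loc C1_on_bump compact_cball[of 0 "2 * R"]]) (use Rpos in \<open>auto simp: bump_0\<close>)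
    \<comment> \<open>The cutoff is 1 with zero gradient on \<open>closure B\<close>, so it affects
      neither \<open>D\<close> nor the reset boundary values of \<open>F\<close>.\<close>
    moreover have "?g R y \<bullet>\<^sub>c F y + ?\<phi> y *\<^sub>R D y
        = ?g R y \<bullet>\<^sub>c (?A1 y \<times>\<^sub>c \<theta>2 y) - ?g R y \<bullet>\<^sub>c (?A2 y \<times>\<^sub>c \<theta>1 y) + D y" for y
    proof -
      have in_R: "norm y < R" if "y \<in> closure B" using R0(1)[of y] that R R0pos by (cases "R0 \<le> norm y") auto
      have "?\<phi> y *\<^sub>R D y = D y"
        using in_R bump_1[of "2 * R" 0 y] Rpos closure_subset[of B] by (auto simp: D_def)
      moreover have "?g R y \<bullet>\<^sub>c F y = ?g R y \<bullet>\<^sub>c ?F y"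
      proof (cases "y \<in> frontier B")
        case True
        then have "norm y < R" by (intro in_R) (auto simp: frontier_def)
        then have "grad ?\<phi> y = 0" using Rpos by (intro grad_bump_inner) auto
        then show ?thesis by simp
      qed (simp add: F_def)
      ultimately show ?thesis by (simp add: bounded_bilinear.diff_right[OF bounded_bilinear_cdot])
    qed
    ultimately have I: "integrable lborel (\<lambda>y. ?g R y \<bullet>\<^sub>c (?A1 y \<times>\<^sub>c \<theta>2 y) - ?g R y \<bullet>\<^sub>c (?A2 y \<times>\<^sub>c \<theta>1 y) + D y)"
      "(LINT y|lborel. ?g R y \<bullet>\<^sub>c (?A1 y \<times>\<^sub>c \<theta>2 y) - ?g R y \<bullet>\<^sub>c (?A2 y \<times>\<^sub>c \<theta>1 y) + D y) = 0"
      by (auto simp: weak_identity_def)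
    note J = C1(1)[OF R] C2(1)[OF R]
    \<comment> \<open>Integrability of \<open>D\<close> is inherited from the weak identity, whose
      integrand is integrable as a whole.\<close>
    from Bochner_Integration.integrable_diff[OF I(1) Bochner_Integration.integrable_diff[OF J]]
    have "integrable lborel D" by simp
    with I(2) J have "(LINT y|lborel. ?g R y \<bullet>\<^sub>c (?A1 y \<times>\<^sub>c \<theta>2 y)) - (LINT y|lborel. ?g R y \<bullet>\<^sub>c (?A2 y \<times>\<^sub>c \<theta>1 y))
        + (LINT y|lborel. D y) = 0" by simp
    then have "(LINT y|lborel. D y) = (LINT y|lborel. ?g R y \<bullet>\<^sub>c (?A2 y \<times>\<^sub>c \<theta>1 y)) - (LINT y|lborel. ?g R y \<bullet>\<^sub>c (?A1 y \<times>\<^sub>c \<theta>2 y))"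
      by (simp add: algebra_simps eq_neg_iff_add_eq_0)
    then have "norm (LINT y|lborel. D y) \<le> norm (LINT y|lborel. ?g R y \<bullet>\<^sub>c (?A2 y \<times>\<^sub>c \<theta>1 y))
        + norm (LINT y|lborel. ?g R y \<bullet>\<^sub>c (?A1 y \<times>\<^sub>c \<theta>2 y))"
      by (simp only: norm_triangle_ineq4)
    with C1(2)[OF R] C2(2)[OF R] have "norm (LINT y|lborel. D y) \<le> C2 / R + C1 / R" by linarith
    then show ?thesis by (simp add: add_divide_distrib)
  qed
  have "((\<lambda>R. (C1 + C2) / R) \<longlongrightarrow> 0) at_top"
    by (intro tendsto_divide_0[OF tendsto_const] filterlim_at_top_imp_at_infinity filterlim_ident)
  moreover have "\<forall>\<^sub>F R in at_top. norm (LINT y|lborel. D y) \<le> (C1 + C2) / R"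
    using est by (auto simp: eventually_at_top_linorder)
  ultimately have "norm (LINT y|lborel. D y) \<le> 0"
    by (intro tendsto_lowerbound) auto
  then show ?thesis unfolding f_def[symmetric] D_def[symmetric] by simp
qed

text \<open>The triple product moves the unit vector onto \<xi>, and together with the monomial of
  \<open>K\<close> this forms \<open>source k K\<close>. What remains is a field part, subject to
  reciprocity, and a symmetric product of sources. Splitting the integral requires integrability,
  which rests on continuity in B and the traces at its boundary.\<close>

lemma gmpt_eq:
  assumes B: "bounded_object B" and t: "transmission_solution B \<nu> 1 j J (\<theta> (j # J))"
  shows "set_integrable lborel B (\<lambda>\<xi>. source k K \<xi> \<bullet>\<^sub>c \<theta> (j # J) \<xi>)"
    and "set_integrable lborel B (\<lambda>\<xi>. source k K \<xi> \<bullet>\<^sub>c source j J \<xi>)"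
    and "gmpt B \<alpha> \<nu> \<theta> k K j J = - (\<i> * of_real \<nu> * of_real \<alpha> ^ (3 + length K + length J)) *
       ((LINT \<xi>:B|lborel. source k K \<xi> \<bullet>\<^sub>c \<theta> (j # J) \<xi>) + (LINT \<xi>:B|lborel. source k K \<xi> \<bullet>\<^sub>c source j J \<xi>))"
proof -
  have oB: "open B" and bB: "bounded B" using B by (auto simp: bounded_object_def)
  let ?t = "\<theta> (j # J)"
  let ?V = "\<lambda>\<xi>. cvec \<xi> \<times>\<^sub>c (of_real (Pi_mon K \<xi>) *s (?t \<xi> + source j J \<xi>))"
  have int: "set_integrable lborel B f" if c: "continuous_on B f"
    and l: "\<And>x. x \<in> frontier B \<Longrightarrow> (f \<longlongrightarrow> l x) (at x within B)" for f l :: "real^3 \<Rightarrow> 'z::euclidean_space"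
  proof (rule set_integrable_continuous_bounded[OF oB bB c])
    show "bounded (f ` B)"
    proof (rule bounded_image_of_traces[OF bB])
      fix x assume "x \<in> closure B"
      then consider "x \<in> B" | "x \<in> frontier B" using oB by (auto simp: frontier_def interior_open)
      then show "\<exists>l. (f \<longlongrightarrow> l) (at x within B)"
        using c l by cases (auto simp: continuous_on_def)
    qed
  qed
  have ct: "continuous_on B ?t"
    using C1_on_continuous t by (auto simp: transmission_solution_def C2_on_def)
  have tt: "\<And>x. x \<in> frontier B \<Longrightarrow> (?t \<longlongrightarrow> trace_in B ?t x) (at x within B)"
    by (rule has_traces_tendsto(1)[OF B transmission_solutionD(2)[OF B t]])
  have lim: "(h \<longlongrightarrow> h x) (at x within B)" if "continuous_on UNIV h" for h :: "real^3 \<Rightarrow> 'z::topological_space" and x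
    using that by (auto simp: continuous_on_eq_continuous_at continuous_at intro: tendsto_within_subset)
  note ccv = linear_continuous_on[OF bounded_linear_cvec]
  have cP: "continuous_on T (\<lambda>\<xi>. of_real (Pi_mon K \<xi>) :: complex)" for T
    by (intro continuous_intros Pi_mon_continuous)
  note bil = bounded_bilinear_cdot bounded_bilinear_ccross bounded_bilinear_smult
  note lims = lim[OF source_continuous] lim[OF ccv] lim[OF cP] tt
  show i1: "set_integrable lborel B (\<lambda>\<xi>. source k K \<xi> \<bullet>\<^sub>c ?t \<xi>)"
    by (rule int, intro bounded_bilinear.continuous_on[OF bil(1)] source_continuous ct)
      (rule bounded_bilinear.tendsto[OF bil(1)]; rule lims; assumption)
  show i2: "set_integrable lborel B (\<lambda>\<xi>. source k K \<xi> \<bullet>\<^sub>c source j J \<xi>)"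
    by (rule int, intro bounded_bilinear.continuous_on[OF bil(1)] source_continuous)
      (rule bounded_bilinear.tendsto[OF bil(1)]; rule lims)
  have V: "set_integrable lborel B ?V"
    by (rule int, intro bounded_bilinear.continuous_on[OF bil(2)] bounded_bilinear.continuous_on[OF bil(3)]
        continuous_on_add source_continuous ccv cP ct)
      (rule bounded_bilinear.tendsto[OF bil(2)], rule lims, rule bounded_bilinear.tendsto[OF bil(3)],
       rule lims, rule tendsto_add, rule lims, assumption, rule lims)
  have pt: "unit_vec k \<bullet>\<^sub>c ?V \<xi> = source k K \<xi> \<bullet>\<^sub>c ?t \<xi> + source k K \<xi> \<bullet>\<^sub>c source j J \<xi>" for \<xi>
    unfolding ccross_triple(1) by (simp add: source_def[of k] cdot_3 algebra_simps)
  have "unit_vec k \<bullet>\<^sub>c (LINT \<xi>:B|lborel. ?V \<xi>) = (LINT \<xi>:B|lborel. unit_vec k \<bullet>\<^sub>c ?V \<xi>)"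
    using integral_bounded_linear[OF bounded_bilinear.bounded_linear_right[OF bil(1), of "unit_vec k"] V[unfolded set_integrable_def]]
    by (simp add: set_lebesgue_integral_def bounded_bilinear.scaleR_right[OF bil(1)])
  also have "\<dots> = (LINT \<xi>:B|lborel. source k K \<xi> \<bullet>\<^sub>c ?t \<xi>) + (LINT \<xi>:B|lborel. source k K \<xi> \<bullet>\<^sub>c source j J \<xi>)"
    unfolding pt by (rule set_integral_add(2)[OF i1 i2])
  finally show "gmpt B \<alpha> \<nu> \<theta> k K j J = - (\<i> * of_real \<nu> * of_real \<alpha> ^ (3 + length K + length J)) *
       ((LINT \<xi>:B|lborel. source k K \<xi> \<bullet>\<^sub>c ?t \<xi>) + (LINT \<xi>:B|lborel. source k K \<xi> \<bullet>\<^sub>c source j J \<xi>))"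
    unfolding gmpt_def source_def[of j] by simp
qed

theorem lemma5p1:
  fixes B :: "(real^3) set"
    and \<alpha> \<omega> \<sigma>\<^sub>s \<mu>\<^sub>s \<mu>\<^sub>0 \<nu> \<mu>\<^sub>r :: real
    and \<theta> :: "3 list \<Rightarrow> real^3 \<Rightarrow> complex^3"
    and m p :: nat and k j :: 3 and K J :: "3 list"
  assumes "bounded_object B"
    and "\<alpha> > 0" and "\<mu>\<^sub>0 > 0"
    and "\<nu> = \<omega> * \<sigma>\<^sub>s * \<mu>\<^sub>0 * \<alpha>\<^sup>2" and "\<mu>\<^sub>r = \<mu>\<^sub>s / \<mu>\<^sub>0"
    and "length K = m" and "length J = p"
    and "transmission_solution B \<nu> \<mu>\<^sub>r k K (\<theta> (k # K))"
    and "transmission_solution B \<nu> \<mu>\<^sub>r j J (\<theta> (j # J))"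
    and "\<mu>\<^sub>s = \<mu>\<^sub>0"
  shows "gmpt B \<alpha> \<nu> \<theta> k K j J = gmpt B \<alpha> \<nu> \<theta> j J k K"
proof -
  have "\<mu>\<^sub>r = 1" using assms by simp
  then have tk: "transmission_solution B \<nu> 1 k K (\<theta> (k # K))" and tj: "transmission_solution B \<nu> 1 j J (\<theta> (j # J))"
    using assms by auto
  note gk = gmpt_eq[where \<theta>=\<theta> and k=k and K=K, OF assms(1) tj] and gj = gmpt_eq[where \<theta>=\<theta> and k=j and K=J, OF assms(1) tk]
  let ?kj = "LINT \<xi>:B|lborel. source k K \<xi> \<bullet>\<^sub>c \<theta> (j # J) \<xi>" and ?jk = "LINT \<xi>:B|lborel. source j J \<xi> \<bullet>\<^sub>c \<theta> (k # K) \<xi>"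
  let ?D = "\<lambda>\<xi>. (\<i> * of_real \<nu>) * (source k K \<xi> \<bullet>\<^sub>c \<theta> (j # J) \<xi> - source j J \<xi> \<bullet>\<^sub>c \<theta> (k # K) \<xi>)"
  have "0 = (LINT \<xi>|lborel. (if \<xi> \<in> B then ?D \<xi> else 0))"
    by (rule reciprocity[OF assms(1) tk tj, symmetric])
  also have "\<dots> = (LINT \<xi>:B|lborel. ?D \<xi>)"
    unfolding set_lebesgue_integral_def by (intro Bochner_Integration.integral_cong) (auto simp: indicator_def)
  also have "\<dots> = (\<i> * of_real \<nu>) * (?kj - ?jk)"
    using gk(1) gj(1) by simp
  \<comment> \<open>The factor with \<nu> stays on both sides, since \<nu> may be 0; the prefactor
    in \<open>gmpt\<close> contains it as well.\<close>
  finally have "(\<i> * of_real \<nu>) * ?kj = (\<i> * of_real \<nu>) * ?jk" by (auto simp: right_diff_distrib)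
  moreover have "\<i> * of_real \<nu> * of_real \<alpha> ^ n * z = of_real \<alpha> ^ n * (\<i> * of_real \<nu> * z)" for n and z :: complex
    by (simp only: mult_ac)
  ultimately have eq: "\<i> * of_real \<nu> * of_real \<alpha> ^ n * ?kj = \<i> * of_real \<nu> * of_real \<alpha> ^ n * ?jk" for n
    by (simp only:)
  have n: "3 + length J + length K = 3 + length K + length J" by simp
  show ?thesis
    unfolding gk(3) gj(3) n mult_minus_left distrib_left eq cdot_commute[of "source j J _" "source k K _"] ..
qed

end
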